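(* There are infinitely many primitive numbers.
   Context: Let $\mu$ be the unique Borel probability measure on $\mathbb{R}$ satisfying $\mu(E)=\frac12\left(\mu(\tau_0^{-1}E)+\mu(\tau_2^{-1}E)\right)$ for all Borel sets $E$, where $\tau_0(x)=x/4$ and $\tau_2(x)=(x+2)/4$ (the Jorgensen–Pedersen measure on the quarter Cantor set). For an odd $m\in\mathbb{N}$ let $\Gamma(m)=\{\sum_{k=0}^n 4^k l_k : l_k\in\{0,m\}, n\in\mathbb{N}\}$. The odd number $m$ is called complete if $\{e^{2\pi i\lambda x}:\lambda\in\Gamma(m)\}$ is an orthonormal basis of $L^2(\mu)$, and incomplete otherwise. An odd number $m$ is called primitive if $m$ is incomplete and every proper divisor $d$ of $m$ ($d<m$, including $d=1$) is complete. (Known fact from prior work: $m$ is complete if and only if the only extreme cycle for the digits $\{0,m\}$ is $\{0\}$, where a finite set $\{x_0,\dots,x_{r-1}\}\subset\mathbb{R}$ is an extreme cycle for $\{0,m\}$ if there are $l_0,\dots,l_{r-1}\in\{0,m\}$ with $x_{k+1}=(x_k+l_k)/4$ for $0\le k\le r-2$, $x_0=(x_{r-1}+l_{r-1})/4$, and $\left|\frac{1+e^{2\pi i\cdot 2x_k}}{2}\right|=1$ for all $k$.) *)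

theory Defs
  imports "HOL-Probability.Probability"
begin

definition \<tau>0 :: "real \<Rightarrow> real" where "\<tau>0 x = x / 4"

definition \<tau>2 :: "real \<Rightarrow> real" where "\<tau>2 x = (x + 2) / 4"

definition jp_invariant :: "real measure \<Rightarrow> bool" where
  "jp_invariant M \<longleftrightarrow> prob_space M \<and> sets M = sets borel \<and>
     (\<forall>E\<in>sets borel. measure M E = 1/2 * (measure M (\<tau>0 -` E) + measure M (\<tau>2 -` E)))"

text \<open>Well-definedness of this description is the lemma \<open>jp_invariant_ex1\<close> at the end.\<close>

definition jp_measure :: "real measure" where
  "jp_measure = (THE M. jp_invariant M)"

text \<open>
  Elements of \<open>L\<^sup>2(M)\<close> are represented by measurable square-integrable functions, not by
  classes modulo null sets, so distinct members of a basis are distinct functions and the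
  orthogonality condition also forbids two of them from agreeing almost everywhere.
\<close>

definition L2_functions :: "'a measure \<Rightarrow> ('a \<Rightarrow> complex) set" where
  "L2_functions M = {f \<in> borel_measurable M. integrable M (\<lambda>x. (cmod (f x))\<^sup>2)}"

definition L2_inner :: "'a measure \<Rightarrow> ('a \<Rightarrow> complex) \<Rightarrow> ('a \<Rightarrow> complex) \<Rightarrow> complex" where
  "L2_inner M f g = (\<integral>x. f x * cnj (g x) \<partial>M)"

definition L2_norm :: "'a measure \<Rightarrow> ('a \<Rightarrow> complex) \<Rightarrow> real" where
  "L2_norm M f = sqrt (\<integral>x. (cmod (f x))\<^sup>2 \<partial>M)"

text \<open>An orthonormal basis is an orthonormal set whose linear span is dense.\<close>

definition L2_orthonormal_basis :: "'a measure \<Rightarrow> ('a \<Rightarrow> complex) set \<Rightarrow> bool" where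
  "L2_orthonormal_basis M B \<longleftrightarrow>
     B \<subseteq> L2_functions M \<and>
     (\<forall>f\<in>B. \<forall>g\<in>B. L2_inner M f g = (if f = g then 1 else 0)) \<and>
     (\<forall>f\<in>L2_functions M. \<forall>\<epsilon>>0. \<exists>F c. finite F \<and> F \<subseteq> B \<and>
        L2_norm M (\<lambda>x. f x - (\<Sum>g\<in>F. c g * g x)) < \<epsilon>)"

definition \<Gamma> :: "nat \<Rightarrow> nat set" where
  "\<Gamma> m = {(\<Sum>k=0..n. 4 ^ k * l k) | n l. \<forall>k\<in>{0..n}. l k \<in> {0, m}}"

definition expo :: "nat \<Rightarrow> real \<Rightarrow> complex" where
  "expo n x = exp (2 * pi * \<i> * of_nat n * of_real x)"

definition complete_number :: "nat \<Rightarrow> bool" where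
  "complete_number m \<longleftrightarrow> odd m \<and> L2_orthonormal_basis jp_measure {expo n | n. n \<in> \<Gamma> m}"

definition incomplete_number :: "nat \<Rightarrow> bool" where
  "incomplete_number m \<longleftrightarrow> odd m \<and> \<not> complete_number m"

definition primitive_number :: "nat \<Rightarrow> bool" where
  "primitive_number m \<longleftrightarrow>
     incomplete_number m \<and> (\<forall>d. d dvd m \<and> d < m \<longrightarrow> complete_number d)"

definition jp_digit :: "bool \<Rightarrow> real" where "jp_digit b = (if b then 2 else 0)"

definition jp_point :: "bool stream \<Rightarrow> real" where
  "jp_point \<omega> = (\<Sum>n. jp_digit (\<omega> !! n) / 4 ^ Suc n)"

lemma summable_jp_point: "summable (\<lambda>n. jp_digit (\<omega> !! n) / 4 ^ Suc n)"
proof (rule summable_comparison_test')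
  show "summable (\<lambda>n. 2 * (1/4::real) ^ Suc n)"
    by (intro summable_mult summable_Suc_iff[THEN iffD2] summable_geometric) simp
  show "norm (jp_digit (\<omega> !! n) / 4 ^ Suc n) \<le> 2 * (1/4::real) ^ Suc n" for n
    by (simp add: jp_digit_def power_one_over)
qed

lemma jp_point_Cons: "jp_point (b ## \<omega>) = (jp_point \<omega> + jp_digit b) / 4"
proof -
  have "jp_point (b ## \<omega>) =
      (\<Sum>n. jp_digit ((b ## \<omega>) !! Suc n) / 4 ^ Suc (Suc n)) + jp_digit b / 4"
    unfolding jp_point_def using suminf_split_head[OF summable_jp_point[of "b ## \<omega>"]] by simp
  also have "(\<Sum>n. jp_digit ((b ## \<omega>) !! Suc n) / 4 ^ Suc (Suc n)) =
      (\<Sum>n. (jp_digit (\<omega> !! n) / 4 ^ Suc n) / 4)"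
    by (simp add: mult.commute)
  also have "\<dots> = jp_point \<omega> / 4"
    unfolding jp_point_def by (rule suminf_divide[OF summable_jp_point])
  finally show ?thesis by (simp add: add_divide_distrib)
qed

abbreviation coin :: "bool measure" where "coin \<equiv> measure_pmf (bernoulli_pmf (1/2))"

lemma jp_point_measurable [measurable]: "jp_point \<in> borel_measurable (stream_space coin)"
proof -
  have [measurable]: "(\<lambda>\<omega>. jp_digit (\<omega> !! n)) \<in> borel_measurable (stream_space coin)" for n
    by (rule measurable_compose[OF measurable_snth]) simp
  show ?thesis unfolding jp_point_def[abs_def] by measurable
qed

lemma \<tau>_measurable [measurable]: "\<tau>0 \<in> borel_measurable borel" "\<tau>2 \<in> borel_measurable borel"
  unfolding \<tau>0_def[abs_def] \<tau>2_def[abs_def] by measurable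

lemma ennreal_half: "ennreal (1/2 * (a + b)) = (ennreal a + ennreal b) / 2"
  if "0 \<le> a" "0 \<le> b"
  using that by (simp add: ennreal_plus[symmetric] divide_ennreal[symmetric] del: ennreal_plus)

lemma jp_invariant_exists: "\<exists>M. jp_invariant M"
proof
  let ?S = "stream_space coin"
  let ?M = "distr ?S borel jp_point"
  interpret S: prob_space ?S by (rule prob_space.prob_space_stream_space[OF measure_pmf.prob_space_axioms])
  interpret M: prob_space ?M by (rule S.prob_space_distr) measurable
  have "measure ?M E = 1/2 * (measure ?M (\<tau>0 -` E) + measure ?M (\<tau>2 -` E))"
    if E [measurable]: "E \<in> sets borel" for E
  proof -
    have sp: "space ?S = UNIV" by (simp add: space_stream_space)
    have [measurable]: "\<tau>0 -` E \<in> sets borel" "\<tau>2 -` E \<in> sets borel"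
      using measurable_sets[OF \<tau>_measurable(1) E] measurable_sets[OF \<tau>_measurable(2) E] by simp_all
    have [measurable]: "jp_point -` E \<in> sets ?S"
      using measurable_sets[OF jp_point_measurable E] by (simp add: sp)
    have "emeasure ?M E = emeasure ?S (jp_point -` E)"
      by (simp add: emeasure_distr sp)
    also have "\<dots> = (\<integral>\<^sup>+b. emeasure ?S {\<omega>. b ## \<omega> \<in> jp_point -` E} \<partial>coin)"
      by (subst prob_space.emeasure_stream_space[OF measure_pmf.prob_space_axioms]) (simp_all add: sp)
    also have "\<dots> = (emeasure ?S {\<omega>. False ## \<omega> \<in> jp_point -` E}
        + emeasure ?S {\<omega>. True ## \<omega> \<in> jp_point -` E}) / 2"
      by (subst nn_integral_measure_pmf_finite)
         (auto simp: UNIV_bool set_pmf_bernoulli divide_ennreal_def distrib_right ennreal_divide_self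
           simp flip: ennreal_half divide_ennreal)
    also have "{\<omega>. False ## \<omega> \<in> jp_point -` E} = jp_point -` (\<tau>0 -` E)"
      by (auto simp: jp_point_Cons jp_digit_def \<tau>0_def)
    also have "{\<omega>. True ## \<omega> \<in> jp_point -` E} = jp_point -` (\<tau>2 -` E)"
      by (auto simp: jp_point_Cons jp_digit_def \<tau>2_def)
    finally have "emeasure ?M E = (emeasure ?M (\<tau>0 -` E) + emeasure ?M (\<tau>2 -` E)) / 2"
      by (simp add: emeasure_distr sp)
    then have "ennreal (measure ?M E) = ennreal (1/2 * (measure ?M (\<tau>0 -` E) + measure ?M (\<tau>2 -` E)))"
      by (subst ennreal_half) (simp_all add: M.emeasure_eq_measure)
    then show ?thesis by (subst (asm) ennreal_inj) auto
  qed
  then show "jp_invariant ?M"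
    unfolding jp_invariant_def using M.prob_space_axioms by simp
qed

lemma char_jp_invariant:
  assumes "jp_invariant M"
  shows "char M t = (1 + iexp (t / 2)) / 2 * char M (t / 4)"
proof -
  have M: "prob_space M" "sets M = sets borel" 
    and inv: "\<And>E. E \<in> sets borel \<Longrightarrow> measure M E = 1/2 * (measure M (\<tau>0 -` E) + measure M (\<tau>2 -` E))"
    using assms by (auto simp: jp_invariant_def)
  note [measurable_cong] = M(2)
  have sp: "space M = UNIV" using sets_eq_imp_space_eq[OF M(2)] by simp
  interpret M: prob_space M by fact
  interpret P: pair_prob_space coin M ..
  let ?h = "\<lambda>(b, x). (x + jp_digit b) / 4"
  have [measurable]: "(\<lambda>p. jp_digit (fst p)) \<in> borel_measurable (coin \<Otimes>\<^sub>M M)"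
    by (rule measurable_compose[OF measurable_fst]) simp
  have h [measurable]: "?h \<in> borel_measurable (coin \<Otimes>\<^sub>M M)"
    unfolding split_beta' by measurable
  have eq: "M = distr (coin \<Otimes>\<^sub>M M) borel ?h"
  proof (rule measure_eqI)
    fix E assume "E \<in> sets M"
    then have E [measurable]: "E \<in> sets borel" by (simp add: M(2))
    have "emeasure (distr (coin \<Otimes>\<^sub>M M) borel ?h) E = emeasure (coin \<Otimes>\<^sub>M M) (?h -` E \<inter> space (coin \<Otimes>\<^sub>M M))"
      by (rule emeasure_distr) measurable
    also have "\<dots> = (\<integral>\<^sup>+b. emeasure M (Pair b -` (?h -` E \<inter> space (coin \<Otimes>\<^sub>M M))) \<partial>coin)"
      by (rule M.emeasure_pair_measure_alt) measurable
    also have "\<dots> = (emeasure M (\<tau>0 -` E) + emeasure M (\<tau>2 -` E)) / 2"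
    proof -
      have "Pair False -` (?h -` E \<inter> space (coin \<Otimes>\<^sub>M M)) = \<tau>0 -` E"
        "Pair True -` (?h -` E \<inter> space (coin \<Otimes>\<^sub>M M)) = \<tau>2 -` E"
        by (auto simp: space_pair_measure sp jp_digit_def \<tau>0_def \<tau>2_def)
      then show ?thesis
      by (subst nn_integral_measure_pmf_finite)
         (auto simp: UNIV_bool set_pmf_bernoulli divide_ennreal_def distrib_right ennreal_divide_self
           simp flip: ennreal_half divide_ennreal)
    qed
    also have "\<dots> = emeasure M E"
      by (simp only: M.emeasure_eq_measure inv[OF E] ennreal_half measure_nonneg)
    finally show "emeasure M E = emeasure (distr (coin \<Otimes>\<^sub>M M) borel ?h) E" ..
  qed (simp add: M(2))
  have int: "integrable M (\<lambda>x. iexp (s * x))" for s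
    by (rule M.integrable_iexp) (simp_all add: measurable_cong_sets[OF M(2)])
  have "char M t = (CLINT p|coin \<Otimes>\<^sub>M M. iexp (t * ?h p))"
    unfolding char_def by (subst eq, subst integral_distr) simp_all
  also have "\<dots> = (CLINT b|coin. CLINT x|M. iexp (t * ?h (b, x)))"
    by (rule P.integral_fst'[symmetric], rule P.P.integrable_iexp) simp_all
  also have "\<dots> = (CLINT b|coin. iexp (t * jp_digit b / 4) * char M (t / 4))"
  proof (rule Bochner_Integration.integral_cong[OF refl])
    fix b
    have "(CLINT x|M. iexp (t * ?h (b, x))) = (CLINT x|M. iexp (t * jp_digit b / 4) * iexp (t / 4 * x))"
      by (simp add: exp_add[symmetric] algebra_simps add_divide_distrib)
    also have "\<dots> = iexp (t * jp_digit b / 4) * char M (t / 4)"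
      unfolding char_def by (rule Bochner_Integration.integral_mult_right) (rule int)
    finally show "(CLINT x|M. iexp (t * ?h (b, x))) = \<dots>" .
  qed
  also have "\<dots> = (1 + iexp (t / 2)) / 2 * char M (t / 4)"
    by (subst integral_measure_pmf[where A = UNIV])
       (auto simp: UNIV_bool jp_digit_def scaleR_conv_of_real algebra_simps add_divide_distrib)
  finally show ?thesis .
qed

lemma jp_invariant_unique:
  assumes "jp_invariant M" "jp_invariant N"
  shows "M = N"
proof -
  have rd: "real_distribution M" "real_distribution N"
    using assms sets_eq_imp_space_eq
    by (auto simp: jp_invariant_def real_distribution_def real_distribution_axioms_def)
  have step: "cmod (char M t - char N t) \<le> cmod (char M (t/4) - char N (t/4))" for t
  proof -
    have "char M t - char N t = (1 + iexp (t / 2)) / 2 * (char M (t/4) - char N (t/4))"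
      by (simp add: char_jp_invariant[OF assms(1), of t] char_jp_invariant[OF assms(2), of t]
          right_diff_distrib)
    moreover have "cmod ((1 + iexp (t / 2)) / 2) \<le> 1"
      using norm_triangle_ineq[of 1 "iexp (t / 2)"] by (simp add: norm_divide)
    ultimately show ?thesis
      by (simp only: norm_mult) (rule mult_left_le_one_le, simp_all)
  qed
  have "char M t = char N t" for t
  proof -
    have le: "cmod (char M t - char N t) \<le> cmod (char M (t / 4 ^ n) - char N (t / 4 ^ n))" for n
    proof (induction n)
      case (Suc n)
      show ?case using Suc.IH step[of "t / 4 ^ n"] by (simp add: mult.commute)
    qed simp
    have t0: "(\<lambda>n. t / 4 ^ n) \<longlonglongrightarrow> 0"
      using tendsto_mult_right[OF LIMSEQ_power_zero[of "1/4::real"], of t]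
      by (simp add: power_one_over field_simps)
    have "(\<lambda>n. cmod (char M (t / 4 ^ n) - char N (t / 4 ^ n))) \<longlonglongrightarrow> cmod (char M 0 - char N 0)"
      by (intro tendsto_norm tendsto_diff isCont_tendsto_compose[OF real_distribution.isCont_char t0] rd)
    also have "cmod (char M 0 - char N 0) = 0"
      by (simp add: real_distribution.char_zero[OF rd(1)] real_distribution.char_zero[OF rd(2)])
    finally have "cmod (char M t - char N t) \<le> 0"
      by (rule LIMSEQ_le_const) (use le in blast)
    then show ?thesis by simp
  qed
  then show ?thesis by (intro Levy_uniqueness rd) auto
qed

lemma jp_invariant_ex1: "\<exists>!M. jp_invariant M"
  using jp_invariant_exists jp_invariant_unique by blast

lemma jp_invariant_jp_measure: "jp_invariant jp_measure"
  unfolding jp_measure_def by (rule theI'[OF jp_invariant_ex1])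

end

(*
Write phi for the Fourier transform of the measure, so that e_s and e_t have inner product
phi (s - t). The product formula phi t = (1 + e^(i pi t)) / 2 * phi (t / 4) makes phi vanish at all
integers 4^j * u with u odd, in particular at differences of distinct integers with base-4 digits in
{0, 1}; these integers form the spectrum for m = 1.

If 3 m + 1 = 4^r with r >= 3, then m is incomplete: e_(-7) is orthogonal to the exponential of every
m a with a in that set, because 3 (7 + m a) = (21 + 4^r a) - a, and 21 = 1 + 4 + 16 makes both terms
numbers with digits in {0, 1}. The integers -7 - m a are therefore zeros of phi.

The number 1 is complete. The sums of |phi (t + a)|^2 over the a with n digits satisfy the recursion
Q (n + 1) t = cos^2 (pi t / 2) * Q n (t / 4) + sin^2 (pi t / 2) * Q n ((t + 1) / 4), hence converge to 1
geometrically, so all e_t lie in the closed span. Density of trigonometric polynomials in L^2 follows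
from Stone-Weierstrass and inner regularity.

A least incomplete divisor is primitive, and it is not 1. Given finitely many primitive numbers with
product N, Euler's theorem provides an r such that (4^r - 1) / 3 is 1 modulo N, and its primitive
divisors are new.
*)
theory Submission
  imports Defs "HOL-Number_Theory.Residues"
begin

section \<open>Integers with base-4 digits 0 and 1\<close>

inductive_set base4 :: "nat set" where
  zero: "0 \<in> base4"
| quadruple: "a \<in> base4 \<Longrightarrow> 4 * a \<in> base4"
| quadruple_Suc: "a \<in> base4 \<Longrightarrow> 4 * a + 1 \<in> base4"

text \<open>These are the nonzero integers of even 2-adic valuation: repeated division by 4 leads to
  an odd u, where the factor 1 + e^(i pi u) of the product formula vanishes.\<close>

definition even_valuation :: "int \<Rightarrow> bool" where
  "even_valuation z \<longleftrightarrow> (\<exists>j u. odd u \<and> z = 4 ^ j * u)"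

lemma even_valuation_odd: "odd z \<Longrightarrow> even_valuation z"
  unfolding even_valuation_def by (rule exI[of _ 0]) simp

lemma even_valuation_quadruple:
  assumes "even_valuation z"
  shows "even_valuation (4 * z)"
proof -
  obtain j u where "odd u" "z = 4 ^ j * u"
    using assms unfolding even_valuation_def by blast
  then have "4 * z = 4 ^ Suc j * u" by simp
  with \<open>odd u\<close> show ?thesis unfolding even_valuation_def by blast
qed

lemma even_valuation_neg:
  assumes "even_valuation z"
  shows "even_valuation (- z)"
proof -
  obtain j u where "odd u" "z = 4 ^ j * u"
    using assms unfolding even_valuation_def by blast
  then have "odd (- u)" "- z = 4 ^ j * (- u)" by simp_all
  then show ?thesis unfolding even_valuation_def by blast
qed

text \<open>3 is coprime to 4^j, so it divides the odd part and leaves the power of 4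
  unchanged.\<close>

lemma even_valuation_triple:
  assumes "even_valuation (3 * z)"
  shows "even_valuation z"
proof -
  obtain j u where u: "odd u" "3 * z = 4 ^ j * u"
    using assms unfolding even_valuation_def by blast
  have "coprime (3::int) (4 ^ j)" 
  proof -
    have "coprime (3::int) 4" using coprime_add_one_right[of "3::int"] by simp
    then show ?thesis by simp
  qed
  moreover have "3 dvd 4 ^ j * u" using u(2) by (metis dvd_triv_left)
  ultimately have "3 dvd u" by (simp add: coprime_dvd_mult_right_iff)
  then obtain v where "u = 3 * v" by blast
  then have "odd v" "z = 4 ^ j * v" using u by auto
  then show ?thesis unfolding even_valuation_def by blast
qed

lemma base4_cases4:
  assumes "a \<in> base4"
  shows "a div 4 \<in> base4" "a mod 4 \<in> {0, 1}"
proof -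
  have "a div 4 \<in> base4 \<and> a mod 4 \<in> {0, 1}"
    using assms
  proof cases
    case (quadruple_Suc b)
    then have "a div 4 = b" "a mod 4 = 1" by simp_all
    with quadruple_Suc show ?thesis by simp
  qed (auto simp: base4.zero)
  then show "a div 4 \<in> base4" "a mod 4 \<in> {0, 1}" by blast+
qed

text \<open>Stripping equal lowest digits divides the difference by 4. As soon as the lowest digits
  differ, one is 0 and the other 1, and the difference is odd.\<close>

lemma base4_diff_even_valuation:
  "a \<in> base4 \<Longrightarrow> b \<in> base4 \<Longrightarrow> a \<noteq> b \<Longrightarrow> even_valuation (int a - int b)"
proof (induction "a + b" arbitrary: a b rule: less_induct)
  case less
  note a = base4_cases4[OF less.prems(1)] and b = base4_cases4[OF less.prems(2)]
  have split: "int a - int b = 4 * (int (a div 4) - int (b div 4)) + (int (a mod 4) - int (b mod 4))"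
    by presburger
  show ?case
  proof (cases "a mod 4 = b mod 4")
    case True
    then have ne: "a div 4 \<noteq> b div 4" using less.prems(3) by (metis div_mult_mod_eq)
    then have "a div 4 + b div 4 < a + b" by linarith
    with ne have "even_valuation (int (a div 4) - int (b div 4))"
      using less.hyps a(1) b(1) by blast
    then show ?thesis
      using split True even_valuation_quadruple[of "int (a div 4) - int (b div 4)"] by simp
  next
    case False
    then have "odd (int (a mod 4) - int (b mod 4))" using a b by auto
    then have "odd (int a - int b)" unfolding split by simp
    then show ?thesis by (rule even_valuation_odd)
  qed
qed

lemma base4_power_mult: "a \<in> base4 \<Longrightarrow> 4 ^ k * a \<in> base4"
  by (induction k) (auto simp: mult.assoc intro: base4.intros)

lemma \<Gamma>_Suc_digit:
  assumes "a \<in> \<Gamma> m" "d \<in> {0, m}"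
  shows "4 * a + d \<in> \<Gamma> m"
proof -
  obtain n l where l: "a = (\<Sum>k=0..n. 4 ^ k * l k)" "\<forall>k\<in>{0..n}. l k \<in> {0, m}"
    using assms(1) unfolding \<Gamma>_def by blast
  \<comment> \<open>The new digit takes position 0 and every old digit moves up by one
    place.\<close>
  define l' where "l' = case_nat d l"
  have "(\<Sum>k=0..Suc n. 4 ^ k * l' k) = d + (\<Sum>k=0..n. 4 ^ Suc k * l k)"
    by (subst sum.atLeast0_atMost_Suc_shift) (simp add: l'_def)
  also have "\<dots> = 4 * a + d"
    unfolding l(1) by (simp add: sum_distrib_left mult.assoc)
  finally have "4 * a + d = (\<Sum>k=0..Suc n. 4 ^ k * l' k)" ..
  moreover have "\<forall>k\<in>{0..Suc n}. l' k \<in> {0, m}"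
    using assms(2) l(2) by (auto simp: l'_def split: nat.splits)
  ultimately show ?thesis unfolding \<Gamma>_def by blast
qed

text \<open>Factoring out m leaves one digit set common to all m, and its inductive form suits
  induction on the lowest digit.\<close>

lemma \<Gamma>_eq: "\<Gamma> m = (\<lambda>a. m * a) ` base4"
proof
  have "\<forall>k\<in>{0..n}. l k \<in> {0, m} \<Longrightarrow> (\<Sum>k=0..n. 4 ^ k * l k) \<in> (\<lambda>a. m * a) ` base4" for n l
  proof (induction n arbitrary: l)
    case 0
    have "0 \<in> base4" "1 \<in> base4"
      using base4.zero base4.quadruple_Suc[OF base4.zero] by simp_all
    with 0 show ?case by (auto simp: image_iff intro: bexI[of _ 0] bexI[of _ 1])
  next
    case (Suc n)
    have "\<forall>k\<in>{0..n}. l (Suc k) \<in> {0, m}" using Suc.prems by auto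
    from Suc.IH[OF this] obtain a where a: "a \<in> base4" "(\<Sum>k=0..n. 4 ^ k * l (Suc k)) = m * a"
      by blast
    have "(\<Sum>k=0..Suc n. 4 ^ k * l k) = l 0 + 4 * (\<Sum>k=0..n. 4 ^ k * l (Suc k))"
      by (subst sum.atLeast0_atMost_Suc_shift) (simp add: sum_distrib_left mult.assoc)
    also have "\<dots> = l 0 + m * (4 * a)" using a(2) by simp
    finally have eq: "(\<Sum>k=0..Suc n. 4 ^ k * l k) = l 0 + m * (4 * a)" .
    have "l 0 \<in> {0, m}" using Suc.prems by auto
    then have "l 0 + m * (4 * a) \<in> {m * (4 * a), m * (4 * a + 1)}" by auto
    then show ?case unfolding eq using base4.quadruple[OF a(1)] base4.quadruple_Suc[OF a(1)] by blast
  qed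
  then show "\<Gamma> m \<subseteq> (\<lambda>a. m * a) ` base4" unfolding \<Gamma>_def by blast
next
  have "m * a \<in> \<Gamma> m" if "a \<in> base4" for a
    using that
  proof induction
    case zero
    show ?case unfolding \<Gamma>_def by (auto intro!: exI[of _ 0] exI[of _ "\<lambda>_. 0"])
  next
    case (quadruple a)
    then show ?case using \<Gamma>_Suc_digit[of "m * a" m 0] by (simp add: algebra_simps)
  next
    case (quadruple_Suc a)
    then show ?case using \<Gamma>_Suc_digit[of "m * a" m m] by (simp add: algebra_simps)
  qed
  then show "(\<lambda>a. m * a) ` base4 \<subseteq> \<Gamma> m" by blast
qed

section \<open>The numbers (4^n - 1) / 3\<close>

lemma seven_add_even_valuation:
  assumes "a \<in> base4" "3 * m + 1 = 4 ^ (r + 3)"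
  shows "even_valuation (7 + int (m * a))"
proof -
  \<comment> \<open>Horner form: the lowest digits 1, 1, 1 contribute 21 and are followed by r zeros
    and the digits of a. The shift by at least three places prevents overlaps.\<close>
  have "4 * (4 * (4 * (4 ^ r * a) + 1) + 1) + 1 \<in> base4"
    by (intro base4.quadruple_Suc base4_power_mult assms)
  then have "21 + 4 ^ (r + 3) * a \<in> base4" by (simp add: algebra_simps power_add)
  moreover have "1 * a \<le> 4 ^ (r + 3) * a" by (rule mult_right_mono) auto
  then have "21 + 4 ^ (r + 3) * a \<noteq> a" by linarith
  ultimately have "even_valuation (int (21 + 4 ^ (r + 3) * a) - int a)"
    by (intro base4_diff_even_valuation assms) simp_all
  also have "int (21 + 4 ^ (r + 3) * a) - int a = 3 * (7 + int (m * a))"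
    unfolding assms(2)[symmetric] by (simp add: algebra_simps)
  finally show ?thesis by (rule even_valuation_triple)
qed

text \<open>Euler's theorem is applied modulo 3 N rather than N, so that after division by 3 the
  number is still 1 modulo N. The exponent 2 t + 1 is at least 3 because t is positive.\<close>

lemma exists_coprime_repunit:
  assumes "odd (N :: nat)"
  obtains m r :: nat where "3 * m + 1 = 4 ^ (r + 3)" "coprime m N" "odd m"
proof -
  define t where "t = totient (3 * N)"
  have N: "N > 0" using assms by (simp add: odd_pos)
  then have "t > 0" by (simp add: t_def)
  have "coprime 4 (3 * N)"
    using assms coprime_power_left_iff[of 2 2 "3 * N"] by simp
  then have "[4 ^ t = 1] (mod 3 * N)" unfolding t_def by (rule euler_theorem)
  then have "[(4 ^ t)\<^sup>2 * 4 = 1\<^sup>2 * 4] (mod 3 * N)" by (intro cong_mult cong_pow) auto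
  then have "[4 ^ (2 * t + 1) = 4] (mod 3 * N)" by (simp add: power_mult power_even_eq mult.commute)
  moreover define X :: nat where "X = 4 ^ (2 * t + 1)"
  moreover have X: "4 \<le> X" unfolding X_def by simp
  ultimately have "3 * N dvd X - 4"
    using cong_altdef_nat[of 4 X "3 * N"] by simp
  then obtain k where "X - 4 = 3 * N * k" by (rule dvdE)
  with X have "X = 3 * (N * k) + 4" by (metis le_add_diff_inverse2 mult.assoc)
  then have k: "3 * (N * k + 1) + 1 = (4::nat) ^ (2 * t + 1)" unfolding X_def by simp
  obtain s where s: "t = Suc s" using \<open>t > 0\<close> gr0_implies_Suc by blast
  have "2 * t + 1 = 2 * s + 3" unfolding s by simp
  note 1 = k[unfolded this]
  have 2: "coprime (N * k + 1) N"
  proof (rule coprimeI)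
    fix c assume "c dvd N * k + 1" "c dvd N"
    then show "is_unit c" using dvd_add_right_iff[of c "N * k" 1] by simp
  qed
  have "even (4 ^ (2 * t + 1) :: nat)" by simp
  then have "odd (N * k + 1)" unfolding k[symmetric] by simp
  with 1 2 show thesis by (rule that)
qed

section \<open>Closed spans in the space of square-integrable functions\<close>

text \<open>A generator may recur in several terms, so sums and multiples need no merging of
  coefficients. The merging happens once, in \<open>L2_span_imp_sum\<close>.\<close>

inductive_set L2_span :: "('a \<Rightarrow> complex) set \<Rightarrow> ('a \<Rightarrow> complex) set" for B where
  zero: "(\<lambda>_. 0) \<in> L2_span B"
| add_term: "p \<in> L2_span B \<Longrightarrow> g \<in> B \<Longrightarrow> (\<lambda>x. p x + c * g x) \<in> L2_span B"

lemma L2_span_base: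
  assumes "g \<in> B"
  shows "(\<lambda>x. c * g x) \<in> L2_span B"
proof -
  have "(\<lambda>x. 0 + c * g x) \<in> L2_span B"
    using L2_span.zero assms by (rule L2_span.add_term)
  then show ?thesis by simp
qed

lemma L2_span_add:
  assumes "p \<in> L2_span B" "q \<in> L2_span B"
  shows "(\<lambda>x. p x + q x) \<in> L2_span B"
  using assms(2)
proof (induction rule: L2_span.induct)
  case zero
  show ?case using assms(1) by simp
next
  case (add_term q g c)
  have "(\<lambda>x. (p x + q x) + c * g x) \<in> L2_span B"
    using add_term.IH add_term.hyps(2) by (rule L2_span.add_term)
  then show ?case by (simp only: add.assoc)
qed

lemma L2_span_scale:
  assumes "p \<in> L2_span B"
  shows "(\<lambda>x. d * p x) \<in> L2_span B"
  using assms
proof (induction rule: L2_span.induct)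
  case zero
  show ?case by (simp add: L2_span.zero)
next
  case (add_term q g c)
  have "(\<lambda>x. d * q x + (d * c) * g x) \<in> L2_span B"
    using add_term.IH add_term.hyps(2) by (rule L2_span.add_term)
  then show ?case by (simp only: distrib_left mult.assoc)
qed

lemma L2_span_imp_sum:
  assumes "p \<in> L2_span B"
  shows "\<exists>F c. finite F \<and> F \<subseteq> B \<and> p = (\<lambda>x. \<Sum>g\<in>F. c g * g x)"
  using assms
proof (induction rule: L2_span.induct)
  case zero
  show ?case by (rule exI[of _ "{}"]) simp
next
  case (add_term p h d)
  then obtain F c where F: "finite F" "F \<subseteq> B" "p = (\<lambda>x. \<Sum>g\<in>F. c g * g x)" by blast
  \<comment> \<open>\<open>c\<close> is arbitrary outside \<open>F\<close>, so it is replaced by 0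
    there; if \<open>h\<close> is already in \<open>F\<close>, the two coefficients add up.\<close>
  define c' where "c' g = (if g \<in> F then c g else 0) + (if g = h then d else 0)" for g
  have "(\<Sum>g\<in>insert h F. c' g * g x) = p x + d * h x" for x
  proof -
    have "(\<Sum>g\<in>insert h F. c' g * g x) =
        (\<Sum>g\<in>insert h F. if g \<in> F then c g * g x else 0) + (\<Sum>g\<in>insert h F. if g = h then d * g x else 0)"
      unfolding sum.distrib[symmetric] by (rule sum.cong) (auto simp: c'_def algebra_simps)
    also have "(\<Sum>g\<in>insert h F. if g \<in> F then c g * g x else 0) = p x"
      unfolding F(3) using F(1) by (intro sum.mono_neutral_cong_right) auto
    also have "(\<Sum>g\<in>insert h F. if g = h then d * g x else 0) = d * h x"
      using F(1) by (subst sum.delta) auto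
    finally show ?thesis .
  qed
  then show ?case using F add_term.hyps
    by (intro exI[of _ "insert h F"] exI[of _ c']) auto
qed

section \<open>The vector space of square-integrable functions\<close>

lemma L2_functions_measurable [measurable_dest]: "f \<in> L2_functions M \<Longrightarrow> f \<in> borel_measurable M"
  by (simp add: L2_functions_def)

lemma L2_functions_integrable: "f \<in> L2_functions M \<Longrightarrow> integrable M (\<lambda>x. (cmod (f x))\<^sup>2)"
  by (simp add: L2_functions_def)

lemma cmod_add_square_le: "(cmod (a + b))\<^sup>2 \<le> 2 * (cmod a)\<^sup>2 + 2 * (cmod b)\<^sup>2"
proof -
  have "(cmod (a + b))\<^sup>2 \<le> (cmod a + cmod b)\<^sup>2"
    by (intro power_mono norm_triangle_ineq) simp
  also have "\<dots> \<le> 2 * (cmod a)\<^sup>2 + 2 * (cmod b)\<^sup>2"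
    using sum_squares_bound[of "cmod a" "cmod b"] by (simp add: power2_sum)
  finally show ?thesis .
qed

lemma L2_functions_add:
  assumes f: "f \<in> L2_functions M" and g: "g \<in> L2_functions M"
  shows "(\<lambda>x. f x + g x) \<in> L2_functions M"
proof -
  note [measurable] = L2_functions_measurable[OF f] L2_functions_measurable[OF g]
  have "integrable M (\<lambda>x. (cmod (f x + g x))\<^sup>2)"
    by (rule Bochner_Integration.integrable_bound[where f = "\<lambda>x. 2 * (cmod (f x))\<^sup>2 + 2 * (cmod (g x))\<^sup>2"])
      (use L2_functions_integrable[OF f] L2_functions_integrable[OF g] cmod_add_square_le in auto)
  then show ?thesis by (simp add: L2_functions_def)
qed

lemma L2_functions_scale:
  assumes f: "f \<in> L2_functions M"
  shows "(\<lambda>x. c * f x) \<in> L2_functions M"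
  using L2_functions_measurable[OF f] L2_functions_integrable[OF f]
  by (simp add: L2_functions_def norm_mult power_mult_distrib)

lemma L2_functions_diff:
  assumes "f \<in> L2_functions M" "g \<in> L2_functions M"
  shows "(\<lambda>x. f x - g x) \<in> L2_functions M"
  using L2_functions_add[OF assms(1) L2_functions_scale[OF assms(2), of "-1"]] by simp

lemma L2_functions_bounded:
  assumes "finite_measure M" "f \<in> borel_measurable M" "\<And>x. x \<in> space M \<Longrightarrow> cmod (f x) \<le> b"
  shows "f \<in> L2_functions M"
proof -
  interpret finite_measure M by fact
  have "integrable M (\<lambda>x. (cmod (f x))\<^sup>2)"
  proof (rule integrable_const_bound)
    show "AE x in M. norm ((cmod (f x))\<^sup>2) \<le> b\<^sup>2"
      using assms(3) by (intro AE_I2) (simp add: power_mono)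
    show "(\<lambda>x. (cmod (f x))\<^sup>2) \<in> borel_measurable M"
      using assms(2) by measurable
  qed
  with assms(2) show ?thesis by (simp add: L2_functions_def)
qed

lemma L2_span_subset_L2:
  assumes "B \<subseteq> L2_functions M" "p \<in> L2_span B"
  shows "p \<in> L2_functions M"
  using assms(2)
proof (induction rule: L2_span.induct)
  case zero
  show ?case by (simp add: L2_functions_def)
next
  case (add_term p g c)
  have "g \<in> L2_functions M" using add_term.hyps(2) assms(1) by blast
  then show ?case by (rule L2_functions_add[OF add_term.IH L2_functions_scale])
qed

text \<open>A substitute for the triangle inequality that stays with squared norms. Its factor 2 is
  the reason for the bounds \<epsilon> / 4 in the closure lemmas.\<close>

lemma L2_square_add_le:
  assumes f: "f \<in> L2_functions M" and g: "g \<in> L2_functions M"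
  shows "(\<integral>x. (cmod (f x + g x))\<^sup>2 \<partial>M) \<le> 2 * (\<integral>x. (cmod (f x))\<^sup>2 \<partial>M) + 2 * (\<integral>x. (cmod (g x))\<^sup>2 \<partial>M)"
proof -
  note i = L2_functions_integrable[OF f] L2_functions_integrable[OF g]
  have "(\<integral>x. (cmod (f x + g x))\<^sup>2 \<partial>M) \<le> (\<integral>x. 2 * (cmod (f x))\<^sup>2 + 2 * (cmod (g x))\<^sup>2 \<partial>M)"
    by (intro integral_mono L2_functions_integrable[OF L2_functions_add[OF f g]] cmod_add_square_le
        Bochner_Integration.integrable_add integrable_mult_right i)
  also have "\<dots> = 2 * (\<integral>x. (cmod (f x))\<^sup>2 \<partial>M) + 2 * (\<integral>x. (cmod (g x))\<^sup>2 \<partial>M)"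
    using i by simp
  finally show ?thesis .
qed

text \<open>Distances are squared to avoid roots until the basis criterion
  \<open>L2_orthonormal_basisI\<close>.\<close>

definition L2_closure :: "'a measure \<Rightarrow> ('a \<Rightarrow> complex) set \<Rightarrow> ('a \<Rightarrow> complex) set" where
  "L2_closure M B = {f \<in> L2_functions M.
     \<forall>\<epsilon>>0. \<exists>p\<in>L2_span B. (\<integral>x. (cmod (f x - p x))\<^sup>2 \<partial>M) < \<epsilon>}"

lemma L2_closure_subset_L2: "f \<in> L2_closure M B \<Longrightarrow> f \<in> L2_functions M"
  by (simp add: L2_closure_def)

lemma L2_closureE:
  assumes "f \<in> L2_closure M B" "\<epsilon> > 0"
  obtains p where "p \<in> L2_span B" "(\<integral>x. (cmod (f x - p x))\<^sup>2 \<partial>M) < \<epsilon>"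
  using assms unfolding L2_closure_def by blast

lemma L2_closure_zero: "(\<lambda>_. 0) \<in> L2_closure M B"
  unfolding L2_closure_def L2_functions_def by (auto intro!: bexI[OF _ L2_span.zero])

lemma L2_closure_scale:
  assumes "f \<in> L2_closure M B"
  shows "(\<lambda>x. c * f x) \<in> L2_closure M B"
proof (cases "c = 0")
  case False
  show ?thesis unfolding L2_closure_def
  proof (intro CollectI conjI allI impI)
    show "(\<lambda>x. c * f x) \<in> L2_functions M"
      using assms by (intro L2_functions_scale L2_closure_subset_L2)
    fix \<epsilon> :: real assume "\<epsilon> > 0"
    then have "\<epsilon> / (cmod c)\<^sup>2 > 0" using False by simp
    with assms obtain p where p: "p \<in> L2_span B" "(\<integral>x. (cmod (f x - p x))\<^sup>2 \<partial>M) < \<epsilon> / (cmod c)\<^sup>2"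
      by (rule L2_closureE)
    have "(\<integral>x. (cmod (c * f x - c * p x))\<^sup>2 \<partial>M) = (cmod c)\<^sup>2 * (\<integral>x. (cmod (f x - p x))\<^sup>2 \<partial>M)"
      by (simp add: norm_mult power_mult_distrib flip: right_diff_distrib)
    also have "\<dots> < \<epsilon>" using p(2) False by (simp add: field_simps)
    finally show "\<exists>p\<in>L2_span B. (\<integral>x. (cmod (c * f x - p x))\<^sup>2 \<partial>M) < \<epsilon>"
      by (rule bexI[OF _ L2_span_scale[OF p(1)]])
  qed
qed (simp add: L2_closure_zero)

section \<open>Stability of the closed span and reduction to indicator functions\<close>

context
  fixes M :: "'a measure" and B :: "('a \<Rightarrow> complex) set"
  assumes B: "B \<subseteq> L2_functions M"
begin

lemma L2_closure_base:
  assumes "g \<in> B"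
  shows "g \<in> L2_closure M B"
proof -
  have "(\<lambda>x. 1 * g x) \<in> L2_span B" using assms by (rule L2_span_base)
  then have "g \<in> L2_span B" by simp
  then have "\<exists>p\<in>L2_span B. (\<integral>x. (cmod (g x - p x))\<^sup>2 \<partial>M) < \<epsilon>" if "\<epsilon> > 0" for \<epsilon>
    using that by (intro bexI[of _ g]) simp_all
  with assms B show ?thesis by (auto simp: L2_closure_def)
qed

lemma L2_closure_add:
  assumes f: "f \<in> L2_closure M B" and g: "g \<in> L2_closure M B"
  shows "(\<lambda>x. f x + g x) \<in> L2_closure M B"
  unfolding L2_closure_def
proof (intro CollectI conjI allI impI)
  note L2 = L2_closure_subset_L2[OF f] L2_closure_subset_L2[OF g]
  show "(\<lambda>x. f x + g x) \<in> L2_functions M" using L2 by (rule L2_functions_add)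
  fix \<epsilon> :: real assume "\<epsilon> > 0"
  then have e: "\<epsilon> / 4 > 0" by simp
  obtain p where p: "p \<in> L2_span B" "(\<integral>x. (cmod (f x - p x))\<^sup>2 \<partial>M) < \<epsilon> / 4"
    using f e by (rule L2_closureE)
  obtain q where q: "q \<in> L2_span B" "(\<integral>x. (cmod (g x - q x))\<^sup>2 \<partial>M) < \<epsilon> / 4"
    using g e by (rule L2_closureE)
  have "(\<integral>x. (cmod (f x + g x - (p x + q x)))\<^sup>2 \<partial>M) = (\<integral>x. (cmod ((f x - p x) + (g x - q x)))\<^sup>2 \<partial>M)"
    by (simp add: algebra_simps)
  also have "\<dots> \<le> 2 * (\<integral>x. (cmod (f x - p x))\<^sup>2 \<partial>M) + 2 * (\<integral>x. (cmod (g x - q x))\<^sup>2 \<partial>M)"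
    by (intro L2_square_add_le L2_functions_diff L2 L2_span_subset_L2[OF B] p q)
  also have "\<dots> < \<epsilon>" using p q by simp
  finally show "\<exists>p\<in>L2_span B. (\<integral>x. (cmod (f x + g x - p x))\<^sup>2 \<partial>M) < \<epsilon>"
    by (rule bexI[OF _ L2_span_add[OF p(1) q(1)]])
qed

lemma L2_closure_span:
  assumes "A \<subseteq> L2_closure M B" "p \<in> L2_span A"
  shows "p \<in> L2_closure M B"
  using assms(2)
proof (induction rule: L2_span.induct)
  case (add_term p g c)
  have "g \<in> L2_closure M B" using add_term.hyps(2) assms(1) by blast
  then show ?case by (rule L2_closure_add[OF add_term.IH L2_closure_scale])
qed (rule L2_closure_zero)

text \<open>The closure is itself closed: approximate first within the closure, then within the
  span.\<close>

lemma L2_closure_limit: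
  assumes f: "f \<in> L2_functions M"
    and lim: "\<And>\<epsilon>. \<epsilon> > 0 \<Longrightarrow> \<exists>g\<in>L2_closure M B. (\<integral>x. (cmod (f x - g x))\<^sup>2 \<partial>M) < \<epsilon>"
  shows "f \<in> L2_closure M B"
  unfolding L2_closure_def
proof (intro CollectI conjI allI impI f)
  fix \<epsilon> :: real assume "\<epsilon> > 0"
  then have e: "\<epsilon> / 4 > 0" by simp
  from lim[OF this] obtain g where g: "g \<in> L2_closure M B" "(\<integral>x. (cmod (f x - g x))\<^sup>2 \<partial>M) < \<epsilon> / 4"
    by blast
  note gL2 = L2_closure_subset_L2[OF g(1)]
  obtain p where p: "p \<in> L2_span B" "(\<integral>x. (cmod (g x - p x))\<^sup>2 \<partial>M) < \<epsilon> / 4"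
    using g(1) e by (rule L2_closureE)
  have "(\<integral>x. (cmod (f x - p x))\<^sup>2 \<partial>M) = (\<integral>x. (cmod ((f x - g x) + (g x - p x)))\<^sup>2 \<partial>M)" by simp
  also have "\<dots> \<le> 2 * (\<integral>x. (cmod (f x - g x))\<^sup>2 \<partial>M) + 2 * (\<integral>x. (cmod (g x - p x))\<^sup>2 \<partial>M)"
    by (intro L2_square_add_le L2_functions_diff f gL2 L2_span_subset_L2[OF B] p)
  also have "\<dots> < \<epsilon>" using g p by simp
  finally show "\<exists>p\<in>L2_span B. (\<integral>x. (cmod (f x - p x))\<^sup>2 \<partial>M) < \<epsilon>" using p(1) by blast
qed

text \<open>Dominated convergence for the squared errors turns pointwise approximation into
  approximation in norm.\<close>

lemma L2_closure_dominated:
  assumes g: "\<And>n. g n \<in> L2_closure M B"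
    and f: "f \<in> L2_functions M" and w: "integrable M w"
    and bound: "\<And>n x. x \<in> space M \<Longrightarrow> (cmod (f x - g n x))\<^sup>2 \<le> w x"
    and lim: "\<And>x. x \<in> space M \<Longrightarrow> (\<lambda>n. g n x) \<longlonglongrightarrow> f x"
  shows "f \<in> L2_closure M B"
proof (rule L2_closure_limit[OF f])
  fix \<epsilon> :: real assume e: "\<epsilon> > 0"
  note [measurable] = L2_functions_measurable[OF f] L2_functions_measurable[OF L2_closure_subset_L2[OF g]]
  have "(\<lambda>n. (\<integral>x. (cmod (f x - g n x))\<^sup>2 \<partial>M)) \<longlonglongrightarrow> (\<integral>x. 0 \<partial>M)"
  proof (rule integral_dominated_convergence[OF _ _ w])
    show "AE x in M. (\<lambda>n. (cmod (f x - g n x))\<^sup>2) \<longlonglongrightarrow> 0"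
    proof (rule AE_I2)
      fix x assume "x \<in> space M"
      then have "(\<lambda>n. (cmod (f x - g n x))\<^sup>2) \<longlonglongrightarrow> (cmod (f x - f x))\<^sup>2"
        by (intro tendsto_intros lim)
      then show "(\<lambda>n. (cmod (f x - g n x))\<^sup>2) \<longlonglongrightarrow> 0" by simp
    qed
  qed (use bound in auto)
  then have "(\<lambda>n. (\<integral>x. (cmod (f x - g n x))\<^sup>2 \<partial>M)) \<longlonglongrightarrow> 0" by simp
  from order_tendstoD(2)[OF this e] obtain n where "(\<integral>x. (cmod (f x - g n x))\<^sup>2 \<partial>M) < \<epsilon>"
    by (auto simp: eventually_sequentially)
  then show "\<exists>g\<in>L2_closure M B. (\<integral>x. (cmod (f x - g x))\<^sup>2 \<partial>M) < \<epsilon>" using g by blast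
qed

lemma L2_closure_sum:
  "finite I \<Longrightarrow> (\<And>i. i \<in> I \<Longrightarrow> f i \<in> L2_closure M B) \<Longrightarrow> (\<lambda>x. \<Sum>i\<in>I. f i x) \<in> L2_closure M B"
proof (induction rule: finite_induct)
  case (insert i I)
  then show ?case using L2_closure_add[of "f i" "\<lambda>x. \<Sum>i\<in>I. f i x"] by simp
qed (simp add: L2_closure_zero)

lemma L2_closure_eq_L2:
  assumes ind: "\<And>A. A \<in> sets M \<Longrightarrow> (\<lambda>x. indicator A x) \<in> L2_closure M B"
  shows "L2_closure M B = L2_functions M"
proof (intro equalityI subsetI L2_closure_subset_L2)
  fix f :: "'a \<Rightarrow> complex" assume f: "f \<in> L2_functions M"
  obtain s where s: "\<And>i. simple_function M (s i)"
    "\<And>x. x \<in> space M \<Longrightarrow> (\<lambda>i. s i x) \<longlonglongrightarrow> f x"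
    "\<And>i x. x \<in> space M \<Longrightarrow> dist (s i x) 0 \<le> 2 * dist (f x) 0"
    using borel_measurable_implies_sequence_metric[OF L2_functions_measurable[OF f], of 0] by blast
  \<comment> \<open>The simple function \<open>s i\<close> rewritten as a finite combination of
    indicators; the two agree on \<open>space M\<close>.\<close>
  let ?t = "\<lambda>i x. \<Sum>y\<in>s i ` space M. y * indicator (s i -` {y} \<inter> space M) x"
  have st: "?t i x = s i x" if "x \<in> space M" for i x
  proof -
    have "?t i x = (\<Sum>y\<in>s i ` space M. if y = s i x then y else 0)"
      using that by (intro sum.cong) (auto simp: indicator_def)
    then show ?thesis
      using that simple_functionD(1)[OF s(1)[of i]] by (simp add: sum.delta)
  qed
  show "f \<in> L2_closure M B"
  \<comment> \<open>From |s i| \<le> 2 |f| follows |f - s i| \<le> 3 |f|, whence the 9.\<close>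
  proof (rule L2_closure_dominated[where g = ?t and w = "\<lambda>x. 9 * (cmod (f x))\<^sup>2"])
    show "?t i \<in> L2_closure M B" for i
      using simple_functionD[OF s(1)[of i]] by (intro L2_closure_sum L2_closure_scale ind) auto
    fix i x assume x: "x \<in> space M"
    have "cmod (f x - s i x) \<le> cmod (f x) + cmod (s i x)" by (rule norm_triangle_ineq4)
    also have "\<dots> \<le> 3 * cmod (f x)" using s(3)[OF x, of i] by simp
    finally have "(cmod (f x - s i x))\<^sup>2 \<le> (3 * cmod (f x))\<^sup>2" by (rule power_mono) simp
    then show "(cmod (f x - ?t i x))\<^sup>2 \<le> 9 * (cmod (f x))\<^sup>2"
      using st[OF x] by (simp add: power_mult_distrib)
  next
    fix x assume "x \<in> space M"
    then show "(\<lambda>i. ?t i x) \<longlonglongrightarrow> f x" using s(2) st by simp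
  qed (use f L2_functions_integrable[OF f] in auto)
qed

end

text \<open>Powers of one continuous function approximate the indicator of a compact set, and inner
  regularity of finite Borel measures on Polish spaces extends this to all Borel sets.\<close>

lemma L2_closure_eq_L2_of_continuous:
  fixes M :: "'a::polish_space measure"
  assumes M: "finite_measure M" "sets M = sets borel" and B: "B \<subseteq> L2_functions M"
    and cont: "\<And>g::'a \<Rightarrow> real. continuous_on UNIV g \<Longrightarrow> range g \<subseteq> {0..1} \<Longrightarrow>
      (\<lambda>x. complex_of_real (g x)) \<in> L2_closure M B"
  shows "L2_closure M B = L2_functions M"
proof (rule L2_closure_eq_L2[OF B])
  interpret finite_measure M by fact
  note [measurable_cong] = M(2)
  have sp: "space M = UNIV" using sets_eq_imp_space_eq[OF M(2)] by simp
  have ind_L2: "(\<lambda>x. indicator A x) \<in> L2_functions M" if "A \<in> sets M" for A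
    using that by (intro L2_functions_bounded[OF M(1), where b = 1]) (auto simp: indicator_def)
  have compact: "(\<lambda>x. indicator K x) \<in> L2_closure M B" if K: "compact K" for K
  \<comment> \<open>\<open>infdist\<close> to the empty set is 0 by convention, so that case is
    treated apart.\<close>
  proof (cases "K = {}")
    case False
    have Kc: "closed K" using K by (rule compact_imp_closed)
    then have "K \<in> sets M" by (simp add: M(2))
    \<comment> \<open>Equal to 1 on the closed set \<open>K\<close> and strictly between 0 and 1
      elsewhere, so the powers tend to the indicator of \<open>K\<close>.\<close>
    define g where "g x = 1 / (1 + infdist x K)" for x
    have g01: "0 < g x" "g x \<le> 1" for x
      using infdist_nonneg[of x K] by (auto simp: g_def)
    have g_cont: "continuous_on UNIV g"
      unfolding g_def using infdist_nonneg[of _ K]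
      by (intro continuous_intros) (metis add_pos_nonneg less_numeral_extra(1) order_less_irrefl)
    show ?thesis
    proof (rule L2_closure_dominated[OF B, where g = "\<lambda>n x. complex_of_real (g x ^ n)" and w = "\<lambda>_. 4"])
      show "(\<lambda>x. complex_of_real (g x ^ n)) \<in> L2_closure M B" for n
        using g01 by (intro cont continuous_on_power g_cont) (auto simp: power_le_one less_imp_le)
      show "(\<lambda>x. indicator K x) \<in> L2_functions M" by (rule ind_L2) fact
      show "integrable M (\<lambda>_. 4)" by simp
      fix x
      have "cmod (indicator K x - complex_of_real (g x ^ n)) \<le> 1 + 1" for n
        using g01[of x] by (intro norm_triangle_le_diff add_mono) (auto simp: norm_power power_le_one indicator_def)
      then have "(cmod (indicator K x - complex_of_real (g x ^ n)))\<^sup>2 \<le> (1 + 1)\<^sup>2" for n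
        by (intro power_mono) auto
      then show "(cmod (indicator K x - complex_of_real (g x ^ n)))\<^sup>2 \<le> 4" for n by simp
      have "(\<lambda>n. g x ^ n) \<longlonglongrightarrow> indicator K x"
      proof (cases "x \<in> K")
        case True
        then show ?thesis by (simp add: g_def)
      next
        case xK: False
        then have "infdist x K > 0"
          using Kc False by (simp add: infdist_pos_not_in_closed)
        then have "g x < 1" by (simp add: g_def)
        then show ?thesis using xK g01[of x] by (simp add: LIMSEQ_power_zero)
      qed
      from tendsto_of_real[OF this]
      have "(\<lambda>n. complex_of_real (g x ^ n)) \<longlonglongrightarrow> complex_of_real (indicator K x)" .
      also have "complex_of_real (indicator K x) = indicator K x" by (simp add: indicator_def)
      finally show "(\<lambda>n. complex_of_real (g x ^ n)) \<longlonglongrightarrow> indicator K x" .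
    qed
  qed (simp add: L2_closure_zero)
  fix A assume A: "A \<in> sets M"
  show "(\<lambda>x. indicator A x) \<in> L2_closure M B"
  proof (rule L2_closure_limit[OF B ind_L2[OF A]])
    fix \<epsilon> :: real assume e: "\<epsilon> > 0"
    have "\<exists>K. K \<subseteq> A \<and> compact K \<and> measure M A < measure M K + \<epsilon>"
    \<comment> \<open>\<open>ennreal\<close> sends negative numbers to 0, so
      \<open>ennreal (measure M A - \<epsilon>)\<close> lies strictly below the measure of
      \<open>A\<close> only if that measure is positive.\<close>
    proof (cases "measure M A = 0")
      case True
      then show ?thesis using e by (intro exI[of _ "{}"]) simp
    next
      case False
      then have pos: "measure M A > 0" by (simp add: zero_less_measure_iff)
      have "ennreal (measure M A - \<epsilon>) < emeasure M A"
        using e pos by (simp add: emeasure_eq_measure ennreal_less_iff ennreal_lessI)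
      also have "emeasure M A = (SUP K \<in> {K. K \<subseteq> A \<and> compact K}. emeasure M K)"
        using A by (intro inner_regular M) (auto simp: M(2))
      finally obtain K where K: "K \<subseteq> A" "compact K" "ennreal (measure M A - \<epsilon>) < emeasure M K"
        unfolding less_SUP_iff by blast
      then have "measure M A - \<epsilon> < measure M K"
        by (metis emeasure_eq_measure ennreal_leI linorder_not_less)
      with K show ?thesis by (intro exI[of _ K]) simp
    qed
    then obtain K where K: "K \<subseteq> A" "compact K" "measure M A < measure M K + \<epsilon>" by blast
    have Ks: "K \<in> sets M" using K(2) by (simp add: M(2) borel_compact)
    have "(\<integral>x. (cmod (indicator A x - indicator K x))\<^sup>2 \<partial>M) = (\<integral>x. indicator (A - K) x \<partial>M)"
      by (intro Bochner_Integration.integral_cong) (use K(1) in \<open>auto simp: indicator_def\<close>)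
    also have "\<dots> = measure M (A - K)" by (simp add: sp)
    also have "\<dots> = measure M A - measure M K"
      using K(1) A Ks by (intro finite_measure_Diff)
    also have "\<dots> < \<epsilon>" using K(3) by simp
    finally show "\<exists>g\<in>L2_closure M B. (\<integral>x. (cmod (indicator A x - g x))\<^sup>2 \<partial>M) < \<epsilon>"
      using compact[OF K(2)] by blast
  qed
qed

section \<open>Inner products, projections and the basis criterion\<close>

lemma L2_mult_integrable:
  assumes f: "f \<in> L2_functions M" and g: "g \<in> L2_functions M"
  shows "integrable M (\<lambda>x. f x * cnj (g x))"
proof (rule Bochner_Integration.integrable_bound[where f = "\<lambda>x. (cmod (f x))\<^sup>2 + (cmod (g x))\<^sup>2"])
  note [measurable] = L2_functions_measurable[OF f] L2_functions_measurable[OF g]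
  have [measurable]: "cnj \<in> borel_measurable borel"
    by (intro borel_measurable_continuous_onI continuous_intros)
  show "(\<lambda>x. f x * cnj (g x)) \<in> borel_measurable M" by measurable
  show "integrable M (\<lambda>x. (cmod (f x))\<^sup>2 + (cmod (g x))\<^sup>2)"
    using L2_functions_integrable[OF f] L2_functions_integrable[OF g] by simp
  have "a * b \<le> a\<^sup>2 + b\<^sup>2" if "a \<ge> 0" "b \<ge> 0" for a b :: real
    using sum_squares_bound[of a b] mult_nonneg_nonneg[OF that] by linarith
  then show "AE x in M. norm (f x * cnj (g x)) \<le> norm ((cmod (f x))\<^sup>2 + (cmod (g x))\<^sup>2)"
    by (intro AE_I2) (simp add: norm_mult)
qed

lemma L2_inner_diff_left:
  assumes "f \<in> L2_functions M" "g \<in> L2_functions M" "h \<in> L2_functions M"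
  shows "L2_inner M (\<lambda>x. f x - g x) h = L2_inner M f h - L2_inner M g h"
  unfolding L2_inner_def using L2_mult_integrable[OF assms(1,3)] L2_mult_integrable[OF assms(2,3)]
  by (simp add: left_diff_distrib)

lemma L2_inner_add_left:
  assumes "f \<in> L2_functions M" "g \<in> L2_functions M" "h \<in> L2_functions M"
  shows "L2_inner M (\<lambda>x. f x + g x) h = L2_inner M f h + L2_inner M g h"
  unfolding L2_inner_def using L2_mult_integrable[OF assms(1,3)] L2_mult_integrable[OF assms(2,3)]
  by (simp add: distrib_right)

lemma L2_inner_scale_left: "L2_inner M (\<lambda>x. c * f x) h = c * L2_inner M f h"
  unfolding L2_inner_def by (simp add: mult.assoc)

lemma L2_inner_cnj: "cnj (L2_inner M f g) = L2_inner M g f"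
  unfolding L2_inner_def by (subst Bochner_Integration.integral_cnj[symmetric]) (simp add: mult.commute)

lemma L2_inner_self: "L2_inner M f f = complex_of_real (\<integral>x. (cmod (f x))\<^sup>2 \<partial>M)"
  unfolding L2_inner_def by (simp only: complex_norm_square[symmetric] integral_complex_of_real)

text \<open>Both claims share one induction, because additivity of the inner product requires the
  partial sum to be square-integrable.\<close>

lemma L2_sum_mem_inner:
  assumes "finite I" "\<And>i. i \<in> I \<Longrightarrow> u i \<in> L2_functions M" "h \<in> L2_functions M"
  shows "(\<lambda>x. \<Sum>i\<in>I. c i * u i x) \<in> L2_functions M \<and>
    L2_inner M (\<lambda>x. \<Sum>i\<in>I. c i * u i x) h = (\<Sum>i\<in>I. c i * L2_inner M (u i) h)"
  using assms(1,2)
proof (induction rule: finite_induct)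
  case empty
  show ?case by (simp add: L2_functions_def L2_inner_def)
next
  case (insert i I)
  then have u: "(\<lambda>x. c i * u i x) \<in> L2_functions M" by (intro L2_functions_scale) simp
  from insert have IH: "(\<lambda>x. \<Sum>i\<in>I. c i * u i x) \<in> L2_functions M"
    "L2_inner M (\<lambda>x. \<Sum>i\<in>I. c i * u i x) h = (\<Sum>i\<in>I. c i * L2_inner M (u i) h)" by auto
  show ?case
    using insert.hyps L2_functions_add[OF u IH(1)] L2_inner_add_left[OF u IH(1) assms(3)] IH(2)
    by (simp add: L2_inner_scale_left)
qed

text \<open>Pythagoras: the error f - p is orthogonal to every \<open>u i\<close>, hence to p, so
  its squared norm is the inner product of f with f - p.\<close>

lemma L2_projection_error:
  assumes I: "finite I" and u: "\<And>i. i \<in> I \<Longrightarrow> u i \<in> L2_functions M" and f: "f \<in> L2_functions M"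
    and orth: "\<And>i j. i \<in> I \<Longrightarrow> j \<in> I \<Longrightarrow> L2_inner M (u i) (u j) = (if i = j then 1 else 0)"
  shows "(\<integral>x. (cmod (f x - (\<Sum>i\<in>I. L2_inner M f (u i) * u i x)))\<^sup>2 \<partial>M) =
    (\<integral>x. (cmod (f x))\<^sup>2 \<partial>M) - (\<Sum>i\<in>I. (cmod (L2_inner M f (u i)))\<^sup>2)"
proof -
  define p where "p x = (\<Sum>i\<in>I. L2_inner M f (u i) * u i x)" for x
  have p: "p \<in> L2_functions M"
    and pi: "h \<in> L2_functions M \<Longrightarrow> L2_inner M p h = (\<Sum>i\<in>I. L2_inner M f (u i) * L2_inner M (u i) h)" for h
    using L2_sum_mem_inner[OF I u f] L2_sum_mem_inner[OF I u, where h = h] unfolding p_def by auto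
  let ?d = "\<lambda>x. f x - p x"
  have d: "?d \<in> L2_functions M" using f p by (rule L2_functions_diff)
  have "L2_inner M ?d (u j) = 0" if j: "j \<in> I" for j
  proof -
    have "L2_inner M p (u j) = (\<Sum>i\<in>I. if i = j then L2_inner M f (u i) else 0)"
      unfolding pi[OF u[OF j]] by (intro sum.cong) (auto simp: orth j)
    also have "\<dots> = L2_inner M f (u j)" using I j by (simp add: sum.delta)
    finally show ?thesis by (simp add: L2_inner_diff_left f p u j)
  qed
  then have "L2_inner M p ?d = 0"
    unfolding pi[OF d] by (intro sum.neutral ballI) (metis L2_inner_cnj complex_cnj_zero mult_zero_right)
  then have "L2_inner M ?d ?d = L2_inner M f ?d"
    by (simp add: L2_inner_diff_left f p d)
  also have "\<dots> = cnj (L2_inner M ?d f)" by (simp add: L2_inner_cnj)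
  also have "L2_inner M ?d f = L2_inner M f f - (\<Sum>i\<in>I. L2_inner M f (u i) * L2_inner M (u i) f)"
    by (simp add: L2_inner_diff_left f p pi)
  also have "(\<Sum>i\<in>I. L2_inner M f (u i) * L2_inner M (u i) f) =
      complex_of_real (\<Sum>i\<in>I. (cmod (L2_inner M f (u i)))\<^sup>2)"
    unfolding of_real_sum L2_inner_cnj[of M f, symmetric]
    by (intro sum.cong refl complex_norm_square[symmetric])
  finally show ?thesis
    unfolding L2_inner_self p_def[symmetric]
    by (metis (no_types, lifting) complex_cnj_complex_of_real of_real_diff of_real_eq_iff)
qed

text \<open>For p in the span of \<open>B\<close>, the squared norm of f - p is 1 plus that of p, so
  f stays at distance at least 1 from the span.\<close>

lemma not_L2_orthonormal_basis_of_orthogonal: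
  assumes f: "f \<in> L2_functions M" "(\<integral>x. (cmod (f x))\<^sup>2 \<partial>M) = 1"
    and orth: "\<And>g. g \<in> B \<Longrightarrow> L2_inner M f g = 0"
  shows "\<not> L2_orthonormal_basis M B"
proof
  assume *: "L2_orthonormal_basis M B"
  then have B: "B \<subseteq> L2_functions M" by (simp add: L2_orthonormal_basis_def)
  from * f(1) obtain F c where F: "finite F" "F \<subseteq> B" "L2_norm M (\<lambda>x. f x - (\<Sum>g\<in>F. c g * g x)) < 1"
    unfolding L2_orthonormal_basis_def using zero_less_one by blast
  define p where "p x = (\<Sum>g\<in>F. c g * g x)" for x
  have p: "p \<in> L2_functions M"
    and pi: "h \<in> L2_functions M \<Longrightarrow> L2_inner M p h = (\<Sum>g\<in>F. c g * L2_inner M g h)" for h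
    using L2_sum_mem_inner[OF F(1), of "\<lambda>g. g" M f c] L2_sum_mem_inner[OF F(1), of "\<lambda>g. g" M h c] F(2) B f(1)
    unfolding p_def by auto
  let ?d = "\<lambda>x. f x - p x"
  have d: "?d \<in> L2_functions M" using f(1) p by (rule L2_functions_diff)
  have pf: "L2_inner M p f = 0"
    unfolding pi[OF f(1)] using orth F(2)
    by (intro sum.neutral ballI) (metis L2_inner_cnj complex_cnj_zero mult_zero_right subsetD)
  then have fp: "L2_inner M f p = 0" by (metis L2_inner_cnj complex_cnj_zero)
  have "L2_inner M ?d ?d = L2_inner M f ?d - L2_inner M p ?d"
    by (rule L2_inner_diff_left[OF f(1) p d])
  also have "\<dots> = cnj (L2_inner M ?d f) - cnj (L2_inner M ?d p)"
    by (simp only: L2_inner_cnj)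
  also have "L2_inner M ?d f = L2_inner M f f" by (simp add: L2_inner_diff_left f(1) p pf)
  also have "L2_inner M ?d p = - L2_inner M p p" by (simp add: L2_inner_diff_left f(1) p fp)
  finally have "complex_of_real (\<integral>x. (cmod (?d x))\<^sup>2 \<partial>M) = complex_of_real (1 + (\<integral>x. (cmod (p x))\<^sup>2 \<partial>M))"
    unfolding L2_inner_self f(2) by simp
  then have "(\<integral>x. (cmod (?d x))\<^sup>2 \<partial>M) \<ge> 1"
    unfolding of_real_eq_iff by (simp add: integral_nonneg_AE)
  then have "L2_norm M ?d \<ge> 1" by (simp add: L2_norm_def)
  with F(3) show False unfolding p_def by simp
qed

lemma L2_orthonormal_basisI:
  assumes B: "B \<subseteq> L2_functions M"
    and orth: "\<And>f g. f \<in> B \<Longrightarrow> g \<in> B \<Longrightarrow> L2_inner M f g = (if f = g then 1 else 0)"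
    and dense: "L2_closure M B = L2_functions M"
  shows "L2_orthonormal_basis M B"
  unfolding L2_orthonormal_basis_def
proof (intro conjI ballI allI impI B orth)
  fix f and \<epsilon> :: real assume "f \<in> L2_functions M" "\<epsilon> > 0"
  then have "f \<in> L2_closure M B" "\<epsilon>\<^sup>2 > 0" using dense by auto
  then obtain p where p: "p \<in> L2_span B" "(\<integral>x. (cmod (f x - p x))\<^sup>2 \<partial>M) < \<epsilon>\<^sup>2" by (rule L2_closureE)
  obtain F c where "finite F" "F \<subseteq> B" "p = (\<lambda>x. \<Sum>g\<in>F. c g * g x)"
    using L2_span_imp_sum[OF p(1)] by blast
  moreover have "L2_norm M (\<lambda>x. f x - p x) < \<epsilon>"
    unfolding L2_norm_def using p(2) \<open>\<epsilon> > 0\<close> by (metis real_sqrt_less_mono real_sqrt_abs abs_of_pos)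
  ultimately show "\<exists>F c. finite F \<and> F \<subseteq> B \<and> L2_norm M (\<lambda>x. f x - (\<Sum>g\<in>F. c g * g x)) < \<epsilon>"
    by blast
qed

section \<open>Exponentials on the quarter Cantor set\<close>

lemma prob_space_jp: "prob_space jp_measure"
  and sets_jp [measurable_cong, simp]: "sets jp_measure = sets borel"
  using jp_invariant_jp_measure by (auto simp: jp_invariant_def)

lemma space_jp [simp]: "space jp_measure = UNIV"
  using sets_eq_imp_space_eq[OF sets_jp] by simp

interpretation jp: prob_space jp_measure
  by (rule prob_space_jp)

lemma prob_jp_UNIV [simp]: "measure jp_measure UNIV = 1"
  using jp.prob_space by simp

text \<open>The preimages of [-R, 1 + R] under both contractions contain [-4R, 1 + 4R], and
  invariance averages their masses.\<close>

lemma jp_measure_interval_le: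
  assumes "R \<ge> 0"
  shows "measure jp_measure {- (4 * R)..1 + 4 * R} \<le> measure jp_measure {- R..1 + R}"
proof -
  let ?S = "{- (4 * R)..1 + 4 * R}"
  have "\<tau>0 -` {- R..1 + R} = {- (4 * R)..4 + 4 * R}" "\<tau>2 -` {- R..1 + R} = {- 2 - 4 * R..2 + 4 * R}"
    by (auto simp: \<tau>0_def \<tau>2_def field_simps)
  then have "measure jp_measure ?S \<le> measure jp_measure (\<tau>0 -` {- R..1 + R})"
    "measure jp_measure ?S \<le> measure jp_measure (\<tau>2 -` {- R..1 + R})"
    by (auto intro!: jp.finite_measure_mono)
  moreover have "measure jp_measure {- R..1 + R} =
      1/2 * (measure jp_measure (\<tau>0 -` {- R..1 + R}) + measure jp_measure (\<tau>2 -` {- R..1 + R}))"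
    using jp_invariant_jp_measure unfolding jp_invariant_def by simp
  moreover have "x \<le> y \<Longrightarrow> x \<le> z \<Longrightarrow> w = 1/2 * (y + z) \<Longrightarrow> x \<le> w" for x y z w :: real
    by simp
  ultimately show ?thesis by blast
qed

text \<open>By iteration the interval has at least the mass of arbitrarily large intervals, which
  exhaust the line.\<close>

lemma measure_jp_interval:
  assumes R: "R > 0"
  shows "measure jp_measure {- R..1 + R} = 1"
proof (rule antisym[OF jp.prob_le_1])
  let ?A = "\<lambda>n. {- (4 ^ n * R)..1 + 4 ^ n * R}"
  have le: "measure jp_measure (?A n) \<le> measure jp_measure {- R..1 + R}" for n
  proof (induction n)
    case (Suc n)
    have "measure jp_measure (?A (Suc n)) \<le> measure jp_measure (?A n)"
      using jp_measure_interval_le[of "4 ^ n * R"] R by (simp add: mult.assoc)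
    with Suc.IH show ?case by linarith
  qed simp
  have "incseq ?A"
  proof (rule incseq_SucI)
    fix n
    have "4 ^ n * R \<le> 4 ^ Suc n * R"
      using R by (intro mult_right_mono power_increasing) auto
    then show "?A n \<le> ?A (Suc n)" by auto
  qed
  then have "(\<lambda>n. measure jp_measure (?A n)) \<longlonglongrightarrow> measure jp_measure (\<Union>n. ?A n)"
    by (intro jp.finite_Lim_measure_incseq) auto
  also have "(\<Union>n. ?A n) = space jp_measure"
  proof -
    have "\<exists>n. x \<in> ?A n" for x
    proof -
      obtain n where "\<bar>x\<bar> / R < 4 ^ n"
        using real_arch_pow[of 4 "\<bar>x\<bar> / R"] by auto
      then have "\<bar>x\<bar> < 4 ^ n * R" using R by (simp add: field_simps)
      then have "x \<in> ?A n" by auto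
      then show ?thesis ..
    qed
    then show ?thesis by auto
  qed
  finally have "(\<lambda>n. measure jp_measure (?A n)) \<longlonglongrightarrow> 1"
    by (simp only: jp.prob_space)
  then show "1 \<le> measure jp_measure {- R..1 + R}"
    by (rule LIMSEQ_le_const2) (use le in blast)
qed

lemma AE_jp_unit_interval: "AE x in jp_measure. x \<in> {0..1}"
proof -
  \<comment> \<open>The exhaustion argument requires R > 0, so [0, 1] is reached as a countable
    intersection.\<close>
  have "AE x in jp_measure. x \<in> {- (1 / real (Suc k))..1 + 1 / real (Suc k)}" for k
    by (intro jp.AE_prob_1 measure_jp_interval) simp
  then have "AE x in jp_measure. \<forall>k. x \<in> {- (1 / real (Suc k))..1 + 1 / real (Suc k)}"
    by (simp only: AE_all_countable) blast
  then show ?thesis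
  proof eventually_elim
    case (elim x)
    have *: "(\<lambda>k. 1 / real (Suc k)) \<longlonglongrightarrow> 0"
      using LIMSEQ_inverse_real_of_nat by (simp add: inverse_eq_divide)
    have "(\<lambda>k. - (1 / real (Suc k))) \<longlonglongrightarrow> - 0" "(\<lambda>k. 1 + 1 / real (Suc k)) \<longlonglongrightarrow> 1 + 0"
      by (intro tendsto_intros *)+
    then have "- 0 \<le> x" "x \<le> 1 + 0"
      using elim by (auto intro: LIMSEQ_le_const LIMSEQ_le_const2)
    then show ?case by simp
  qed
qed

section \<open>Exponentials and the Fourier transform of the measure\<close>

text \<open>Extends \<open>expo\<close> to real frequencies: the product formula passes from t to t
  / 4, and the cosine used in Stone-Weierstrass has frequency 1 / (2 pi).\<close>

definition wave :: "real \<Rightarrow> real \<Rightarrow> complex" where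
  "wave t x = cis (2 * pi * t * x)"

text \<open>The function phi; the factor 2 pi makes its argument the frequency of
  \<open>wave\<close>.\<close>

definition jp_char :: "real \<Rightarrow> complex" where
  "jp_char t = char jp_measure (2 * pi * t)"

lemma expo_eq_wave: "expo n = wave (real n)"
  by (rule ext) (simp add: expo_def wave_def cis_conv_exp mult_ac)

lemma wave_mult: "wave s x * wave t x = wave (s + t) x"
  by (simp add: wave_def cis_mult algebra_simps)

lemma cnj_wave: "cnj (wave t x) = wave (- t) x"
  by (simp add: wave_def cis_cnj)

lemma norm_wave [simp]: "cmod (wave t x) = 1"
  by (simp add: wave_def)

lemma wave_zero [simp]: "wave 0 x = 1"
  by (simp add: wave_def)

lemma continuous_on_wave: "continuous_on A (wave t)"
  unfolding wave_def[abs_def] by (intro continuous_intros)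

lemma wave_L2: "wave t \<in> L2_functions jp_measure"
proof (rule L2_functions_bounded[where b = 1])
  show "wave t \<in> borel_measurable jp_measure"
    using borel_measurable_continuous_onI[OF continuous_on_wave] by simp
qed (use jp.finite_measure_axioms in simp_all)

lemma integral_wave: "(\<integral>x. wave t x \<partial>jp_measure) = jp_char t"
  unfolding jp_char_def char_def by (simp add: wave_def cis_conv_exp)

lemma L2_inner_wave: "L2_inner jp_measure (wave s) (wave t) = jp_char (s - t)"
  unfolding L2_inner_def by (simp add: cnj_wave wave_mult integral_wave)

lemma L2_square_wave: "(\<integral>x. (cmod (wave t x))\<^sup>2 \<partial>jp_measure) = 1"
  by (simp add: jp.prob_space)

lemma jp_char_zero [simp]: "jp_char 0 = 1"
  using integral_wave[of 0] jp.prob_space by simp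

lemma jp_char_minus: "jp_char (- t) = cnj (jp_char t)"
  using L2_inner_cnj[of jp_measure "wave t" "wave 0"] by (simp add: L2_inner_wave)

lemma jp_char_rec: "jp_char t = (1 + cis (pi * t)) / 2 * jp_char (t / 4)"
  using char_jp_invariant[OF jp_invariant_jp_measure, of "2 * pi * t"]
  by (simp add: jp_char_def cis_conv_exp)

lemma cmod_jp_char_square: "(cmod (jp_char t))\<^sup>2 = (cos (pi * t / 2))\<^sup>2 * (cmod (jp_char (t / 4)))\<^sup>2"
proof -
  have "(cmod (1 + cis (pi * t)))\<^sup>2 = (1 + cos (pi * t))\<^sup>2 + (sin (pi * t))\<^sup>2"
    by (simp add: cmod_power2)
  also have "\<dots> = 2 + 2 * cos (pi * t)"
    using sin_cos_squared_add[of "pi * t"] by (simp add: power2_sum)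
  also have "\<dots> = 4 * (cos (pi * t / 2))\<^sup>2"
    using cos_double_cos[of "pi * t / 2"] by simp
  finally have "(cmod ((1 + cis (pi * t)) / 2))\<^sup>2 = (cos (pi * t / 2))\<^sup>2"
    by (simp add: norm_divide power_divide)
  then show ?thesis
    by (subst jp_char_rec) (simp only: norm_mult power_mult_distrib)
qed

lemma cis_int_2pi: "cis (2 * pi * of_int k) = 1"
  by (rule cis_multiple_2pi) simp

text \<open>At a multiple of 4 the factor in the product formula is 1, so phi takes the same value
  at a quarter of it. The descent ends at an odd integer, where the factor is 0.\<close>

lemma jp_char_even_valuation:
  assumes "even_valuation z"
  shows "jp_char (of_int z) = 0"
proof -
  obtain j u where u: "odd u" "z = 4 ^ j * u"
    using assms unfolding even_valuation_def by blast
  have "jp_char (of_int (4 ^ j * u)) = 0"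
  proof (induction j)
    case 0
    obtain k where k: "u = 2 * k + 1" using u(1) by (rule oddE)
    have "cis (pi * of_int u) = cis (2 * pi * of_int k) * cis pi"
      unfolding cis_mult k by (simp add: algebra_simps)
    then have "cis (pi * of_int u) = - 1" unfolding cis_int_2pi by simp
    then show ?case by (subst jp_char_rec) simp
  next
    case (Suc j)
    have "pi * of_int (4 ^ Suc j * u) = 2 * pi * of_int (2 * (4 ^ j * u))" by simp
    then have "cis (pi * of_int (4 ^ Suc j * u)) = 1" by (simp only: cis_int_2pi)
    moreover have "of_int (4 ^ Suc j * u) / 4 = (of_int (4 ^ j * u) :: real)" by simp
    ultimately show ?case by (subst jp_char_rec) (simp only: Suc.IH mult_zero_right)
  qed
  then show ?thesis unfolding u(2) .
qed

lemma cmod_cis_minus_one_le: "cmod (cis y - 1) \<le> \<bar>y\<bar>"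
  using iexp_approx1[of y 0] by (simp add: cis_conv_exp)

text \<open>Since almost all x lie in [0, 1], the bound |e^(iy) - 1| \<le> |y| integrates to a
  Lipschitz estimate at 0, which starts the induction for the energies.\<close>

lemma cmod_jp_char_minus_one_le: "cmod (jp_char t - 1) \<le> 2 * pi * \<bar>t\<bar>"
proof -
  have meas [measurable]: "wave t \<in> borel_measurable jp_measure"
    by (rule L2_functions_measurable[OF wave_L2])
  have int: "integrable jp_measure (wave t)"
    by (rule jp.integrable_const_bound[where B = 1]) (simp_all add: meas)
  have "jp_char t - 1 = (\<integral>x. wave t x - 1 \<partial>jp_measure)"
    using int jp.prob_space by (simp add: integral_wave)
  also have "cmod \<dots> \<le> (\<integral>x. cmod (wave t x - 1) \<partial>jp_measure)"
    by (rule integral_norm_bound)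
  also have "\<dots> \<le> (\<integral>x. 2 * pi * \<bar>t\<bar> \<partial>jp_measure)"
  proof (rule integral_mono_AE)
    show "AE x in jp_measure. cmod (wave t x - 1) \<le> 2 * pi * \<bar>t\<bar>"
      using AE_jp_unit_interval
    proof eventually_elim
      case (elim x)
      have "cmod (wave t x - 1) \<le> \<bar>2 * pi * t * x\<bar>"
        unfolding wave_def by (rule cmod_cis_minus_one_le)
      also have "\<dots> = 2 * pi * \<bar>t\<bar> * \<bar>x\<bar>" by (simp add: abs_mult)
      also have "\<dots> \<le> 2 * pi * \<bar>t\<bar> * 1" using elim by (intro mult_left_mono) auto
      finally show ?case by simp
    qed
    show "integrable jp_measure (\<lambda>x. cmod (wave t x - 1))"
      using int by (intro integrable_norm Bochner_Integration.integrable_diff) simp_all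
  qed simp
  also have "\<dots> = 2 * pi * \<bar>t\<bar>" using jp.prob_space by simp
  finally show ?thesis .
qed

lemma one_minus_cmod_jp_char_square_le: "1 - (cmod (jp_char t))\<^sup>2 \<le> 4 * pi * \<bar>t\<bar>"
proof -
  let ?a = "cmod (jp_char t)"
  have "1 - ?a \<le> cmod (jp_char t - 1)"
    using norm_triangle_ineq2[of 1 "jp_char t"] by (simp add: norm_minus_commute)
  also have "\<dots> \<le> 2 * pi * \<bar>t\<bar>" by (rule cmod_jp_char_minus_one_le)
  finally have "1 - ?a \<le> 2 * pi * \<bar>t\<bar>" .
  \<comment> \<open>Equivalent to (1 - a)^2 \<ge> 0.\<close>
  moreover have "1 - ?a\<^sup>2 \<le> 2 * (1 - ?a)"
    using sum_squares_bound[of ?a 1] by simp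
  ultimately show ?thesis by simp
qed

section \<open>Energy of the projections onto finitely many exponentials\<close>

text \<open>The elements with at most n digits, built by adding a new lowest digit because that is
  the digit on which the product formula acts.\<close>

fun base4_upto :: "nat \<Rightarrow> nat set" where
  "base4_upto 0 = {0}"
| "base4_upto (Suc n) = (\<lambda>a. 4 * a) ` base4_upto n \<union> (\<lambda>a. 4 * a + 1) ` base4_upto n"

lemma finite_base4_upto: "finite (base4_upto n)"
  by (induction n) auto

lemma base4_upto_subset: "base4_upto n \<subseteq> base4"
  by (induction n) (auto intro: base4.zero base4.quadruple base4.quadruple_Suc[simplified])

lemma sum_base4_upto_Suc:
  "(\<Sum>a\<in>base4_upto (Suc n). f a) = (\<Sum>a\<in>base4_upto n. f (4 * a)) + (\<Sum>a\<in>base4_upto n. f (4 * a + 1))"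
proof -
  have "(\<lambda>a. 4 * a) ` base4_upto n \<inter> (\<lambda>a. 4 * a + 1) ` base4_upto n = {}"
    by auto presburger
  then show ?thesis
    by (simp add: sum.union_disjoint finite_base4_upto sum.reindex inj_on_def)
qed

text \<open>This is Q n t. By orthonormality it is the squared norm of the projection of e_(-t) onto
  the span of the chosen exponentials.\<close>

definition jp_energy :: "nat \<Rightarrow> real \<Rightarrow> real" where
  "jp_energy n t = (\<Sum>a\<in>base4_upto n. (cmod (jp_char (t + real a)))\<^sup>2)"

text \<open>The sum splits by the lowest digit of the frequency. Adding 4 a to t leaves cos^2 (pi t
  / 2) unchanged, and the digit 1 turns it into sin^2.\<close>

lemma jp_energy_Suc:
  "jp_energy (Suc n) t =
    (cos (pi * t / 2))\<^sup>2 * jp_energy n (t / 4) + (sin (pi * t / 2))\<^sup>2 * jp_energy n ((t + 1) / 4)"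
proof -
  have shift: "(cmod (jp_char (s + real (4 * a))))\<^sup>2 = (cos (pi * s / 2))\<^sup>2 * (cmod (jp_char (s / 4 + real a)))\<^sup>2"
    for s a
  proof -
    have "pi * (s + real (4 * a)) / 2 = pi * s / 2 + 2 * pi * real a"
      "(s + real (4 * a)) / 4 = s / 4 + real a"
      by (simp_all add: field_simps)
    moreover have "cos (pi * s / 2 + 2 * pi * real a) = cos (pi * s / 2)"
      using cos_int_2pin[of "int a"] sin_int_2pin[of "int a"] by (simp add: cos_add)
    ultimately show ?thesis using cmod_jp_char_square[of "s + real (4 * a)"] by metis
  qed
  have "pi * (t + 1) / 2 = pi * t / 2 + pi / 2" by (simp add: field_simps)
  then have "cos (pi * (t + 1) / 2) = - sin (pi * t / 2)"
    by (simp only: cos_add cos_pi_half sin_pi_half)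
  then have "(cos (pi * (t + 1) / 2))\<^sup>2 = (sin (pi * t / 2))\<^sup>2" by simp
  moreover have "t + real (4 * a + 1) = (t + 1) + real (4 * a)" for a by simp
  ultimately show ?thesis
    unfolding jp_energy_def sum_base4_upto_Suc by (simp only: shift sum_distrib_left)
qed

definition jp_rate :: real where "jp_rate = 1 / 4 + pi / 8"

text \<open>
  In the recursion of \<open>jp_energy_Suc\<close> the weights \<open>cos\<^sup>2\<close> and \<open>sin\<^sup>2\<close> add up to 1, and
  \<open>sin\<^sup>2 (\<pi> t / 2) \<le> \<pi> \<bar>t\<bar> / 2\<close>. So the averaging operator maps \<open>\<bar>t\<bar>\<close> to at most
  \<open>\<bar>t\<bar> / 4 + (\<pi> \<bar>t\<bar> / 2) / 4\<close>, which is where \<open>jp_rate\<close> comes from.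
\<close>

lemma jp_energy_lower: "1 - jp_energy n t \<le> 4 * pi * jp_rate ^ n * \<bar>t\<bar>"
proof (induction n arbitrary: t)
  case 0
  show ?case using one_minus_cmod_jp_char_square_le by (simp add: jp_energy_def)
next
  case (Suc n)
  define K where "K = 4 * pi * jp_rate ^ n"
  have "K \<ge> 0" using pi_gt_zero by (simp add: K_def jp_rate_def)
  define c s where "c = (cos (pi * t / 2))\<^sup>2" and "s = (sin (pi * t / 2))\<^sup>2"
  have cs: "c + s = 1" "c \<ge> 0" "s \<ge> 0" by (simp_all add: c_def s_def)
  have "s = \<bar>sin (pi * t / 2)\<bar> * \<bar>sin (pi * t / 2)\<bar>"
    unfolding s_def by (simp add: power2_eq_square)
  also have "\<dots> \<le> \<bar>sin (pi * t / 2)\<bar> * 1"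
    by (intro mult_left_mono abs_sin_le_one abs_ge_zero)
  also have "\<dots> = \<bar>sin (pi * t / 2)\<bar>" by simp
  also have "\<dots> \<le> \<bar>pi * t / 2\<bar>" by (rule abs_sin_x_le_abs_x)
  also have "\<dots> = pi / 2 * \<bar>t\<bar>" by (simp add: abs_mult)
  finally have s: "s \<le> pi / 2 * \<bar>t\<bar>" .
  have "1 - jp_energy (Suc n) t = c * (1 - jp_energy n (t / 4)) + s * (1 - jp_energy n ((t + 1) / 4))"
    unfolding jp_energy_Suc c_def[symmetric] s_def[symmetric] using cs(1) by (simp add: algebra_simps)
  also have "\<dots> \<le> c * (K * \<bar>t / 4\<bar>) + s * (K * \<bar>(t + 1) / 4\<bar>)"
    unfolding K_def by (intro add_mono mult_left_mono Suc.IH cs)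
  also have "\<dots> \<le> c * (K * (\<bar>t\<bar> / 4)) + s * (K * ((\<bar>t\<bar> + 1) / 4))"
    using \<open>K \<ge> 0\<close> cs by (intro add_mono mult_left_mono) auto
  \<comment> \<open>The summand 1 of |t| + 1 carries only the weight \<open>s\<close>, itself of
    order |t|, so the bound remains proportional to |t|.\<close>
  also have "\<dots> = (c + s) * K * \<bar>t\<bar> / 4 + K * s / 4" by (simp add: field_simps)
  also have "\<dots> \<le> (c + s) * K * \<bar>t\<bar> / 4 + K * (pi / 2 * \<bar>t\<bar>) / 4"
    using mult_left_mono[OF s \<open>K \<ge> 0\<close>] by simp
  also have "\<dots> = K * jp_rate * \<bar>t\<bar>" unfolding cs(1) jp_rate_def by (simp add: field_simps)
  also have "\<dots> = 4 * pi * jp_rate ^ Suc n * \<bar>t\<bar>" by (simp add: K_def)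
  finally show ?case .
qed

lemma expo_subset_L2: "{expo n | n. P n} \<subseteq> L2_functions jp_measure"
  using wave_L2 by (auto simp: expo_eq_wave)

lemma L2_inner_expo_base4:
  assumes "a \<in> base4" "b \<in> base4"
  shows "L2_inner jp_measure (expo a) (expo b) = (if a = b then 1 else 0)"
proof (cases "a = b")
  case False
  then have "jp_char (of_int (int a - int b)) = 0"
    by (intro jp_char_even_valuation base4_diff_even_valuation assms)
  with False show ?thesis by (simp add: expo_eq_wave L2_inner_wave)
qed (simp add: expo_eq_wave L2_inner_wave)

abbreviation expo_base4 :: "(real \<Rightarrow> complex) set" where
  "expo_base4 \<equiv> {expo n | n. n \<in> base4}"

text \<open>The squared error of projecting \<open>wave t\<close> onto the frequencies in
  \<open>base4_upto n\<close> is \<open>1 - jp_energy n (- t)\<close>, which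
  \<open>jp_energy_lower\<close> bounds by a null sequence.\<close>

lemma wave_in_closure: "wave t \<in> L2_closure jp_measure expo_base4"
proof (rule L2_closure_limit[OF expo_subset_L2 wave_L2])
  fix \<epsilon> :: real assume \<epsilon>: "\<epsilon> > 0"
  \<comment> \<open>With pi < 4 the rate is below 1/4 + 1/2.\<close>
  have "0 \<le> jp_rate" "jp_rate < 1" using pi_less_4 pi_gt_zero by (auto simp: jp_rate_def)
  then have "(\<lambda>n. 4 * pi * jp_rate ^ n * \<bar>- t\<bar>) \<longlonglongrightarrow> 4 * pi * 0 * \<bar>- t\<bar>"
    by (intro tendsto_intros LIMSEQ_power_zero) simp
  then have "(\<lambda>n. 4 * pi * jp_rate ^ n * \<bar>- t\<bar>) \<longlonglongrightarrow> 0" by simp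
  from order_tendstoD(2)[OF this \<epsilon>] obtain n where n: "4 * pi * jp_rate ^ n * \<bar>- t\<bar> < \<epsilon>"
    by (auto simp: eventually_sequentially)
  let ?c = "\<lambda>a. L2_inner jp_measure (wave t) (expo a)"
  have sub: "a \<in> base4_upto n \<Longrightarrow> a \<in> base4" for a using base4_upto_subset by blast
  have "(\<integral>x. (cmod (wave t x - (\<Sum>a\<in>base4_upto n. ?c a * expo a x)))\<^sup>2 \<partial>jp_measure) =
      (\<integral>x. (cmod (wave t x))\<^sup>2 \<partial>jp_measure) - (\<Sum>a\<in>base4_upto n. (cmod (?c a))\<^sup>2)"
    by (rule L2_projection_error[OF finite_base4_upto _ wave_L2])
      (simp_all add: L2_inner_expo_base4 sub, simp add: expo_eq_wave wave_L2)
  \<comment> \<open>The coefficient is phi (t - a), conjugate to phi (-t + a); this is why the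
    energy is taken at -t.\<close>
  also have "cmod (?c a) = cmod (jp_char (- t + real a))" for a
    using jp_char_minus[of "- t + real a"] by (simp add: expo_eq_wave L2_inner_wave)
  then have "(\<Sum>a\<in>base4_upto n. (cmod (?c a))\<^sup>2) = jp_energy n (- t)"
    by (simp add: jp_energy_def)
  finally have "(\<integral>x. (cmod (wave t x - (\<Sum>a\<in>base4_upto n. ?c a * expo a x)))\<^sup>2 \<partial>jp_measure) < \<epsilon>"
    using jp_energy_lower[of n "- t"] n unfolding L2_square_wave by linarith
  moreover have "(\<lambda>x. \<Sum>a\<in>base4_upto n. ?c a * expo a x) \<in> L2_closure jp_measure expo_base4"
    using sub by (intro L2_closure_sum expo_subset_L2 finite_base4_upto L2_closure_scale L2_closure_base) auto
  ultimately show "\<exists>g\<in>L2_closure jp_measure expo_base4. (\<integral>x. (cmod (wave t x - g x))\<^sup>2 \<partial>jp_measure) < \<epsilon>"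
    by (rule rev_bexI[rotated])
qed

section \<open>Density of trigonometric polynomials\<close>

text \<open>Multiplying waves adds their frequencies, so the span is an algebra, as
  Stone-Weierstrass demands.\<close>

lemma wave_span_mult:
  assumes p: "p \<in> L2_span (range wave)" and q: "q \<in> L2_span (range wave)"
  shows "(\<lambda>x. p x * q x) \<in> L2_span (range wave)"
  using q
proof (induction rule: L2_span.induct)
  case zero
  show ?case by (simp add: L2_span.zero)
next
  case (add_term q g c)
  then obtain t where g: "g = wave t" by blast
  have "(\<lambda>x. p x * wave t x) \<in> L2_span (range wave)"
    using p
  proof (induction rule: L2_span.induct)
    case zero
    show ?case by (simp add: L2_span.zero)
  next
    case (add_term p h d)
    then obtain s where h: "h = wave s" by blast
    have "(\<lambda>x. p x * wave t x + d * wave (s + t) x) \<in> L2_span (range wave)"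
      using add_term.IH by (rule L2_span.add_term) simp
    then show ?case by (simp only: h distrib_right mult.assoc wave_mult)
  qed
  from L2_span_add[OF add_term.IH L2_span_scale[OF this, of c]]
  have "(\<lambda>x. p x * q x + c * (p x * wave t x)) \<in> L2_span (range wave)" .
  also have "(\<lambda>x. p x * q x + c * (p x * wave t x)) = (\<lambda>x. p x * (q x + c * g x))"
    by (rule ext) (simp add: g algebra_simps)
  finally show ?case .
qed

lemma continuous_on_wave_span:
  assumes "p \<in> L2_span (range wave)"
  shows "continuous_on A p"
  using assms
proof (induction rule: L2_span.induct)
  case (add_term p g c)
  then have "continuous_on A g" using continuous_on_wave by blast
  with add_term.IH show ?case by (intro continuous_intros)
qed simp

text \<open>The real Stone-Weierstrass theorem is applied to those real functions whose complex
  embedding lies in the span.\<close>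

lemma wave_span_dense:
  fixes g :: "real \<Rightarrow> real"
  assumes "continuous_on {0..1} g" "e > 0"
  shows "\<exists>f. (\<lambda>x. complex_of_real (f x)) \<in> L2_span (range wave) \<and> (\<forall>x\<in>{0..1}. \<bar>g x - f x\<bar> < e)"
proof (rule Stone_Weierstrass_HOL[where P = "\<lambda>f. (\<lambda>x. complex_of_real (f x)) \<in> L2_span (range wave)"])
  fix c :: real
  have "(\<lambda>x. complex_of_real c * wave 0 x) \<in> L2_span (range wave)" by (rule L2_span_base[OF rangeI])
  then show "(\<lambda>x. complex_of_real c) \<in> L2_span (range wave)" by simp
next
  fix f :: "real \<Rightarrow> real" assume "(\<lambda>x. complex_of_real (f x)) \<in> L2_span (range wave)"
  then have "continuous_on {0..1} (\<lambda>x. complex_of_real (f x))" by (rule continuous_on_wave_span)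
  from continuous_on_Re[OF this] show "continuous_on {0..1} f" by simp
next
  fix f h :: "real \<Rightarrow> real"
  assume *: "(\<lambda>x. complex_of_real (f x)) \<in> L2_span (range wave) \<and> (\<lambda>x. complex_of_real (h x)) \<in> L2_span (range wave)"
  show "(\<lambda>x. complex_of_real (f x + h x)) \<in> L2_span (range wave)"
    using L2_span_add[OF conjunct1[OF *] conjunct2[OF *]] by simp
  show "(\<lambda>x. complex_of_real (f x * h x)) \<in> L2_span (range wave)"
    using wave_span_mult[OF conjunct1[OF *] conjunct2[OF *]] by simp
next
  fix x y :: real assume xy: "x \<in> {0..1} \<and> y \<in> {0..1} \<and> x \<noteq> y"
  \<comment> \<open>This frequency yields cos x itself, which is injective on [0, pi] and so
    separates points of [0, 1]. Integer frequencies alone would not separate 0 from 1.\<close>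
  let ?s = "1 / (2 * pi)"
  have "(\<lambda>x. (1/2) * wave ?s x + (1/2) * wave (- ?s) x) \<in> L2_span (range wave)"
    by (intro L2_span_add L2_span_base) simp_all
  also have "(\<lambda>x. (1/2) * wave ?s x + (1/2) * wave (- ?s) x) = (\<lambda>x. complex_of_real (cos x))"
    by (rule ext) (simp add: wave_def complex_eq_iff)
  finally have "(\<lambda>x. complex_of_real (cos x)) \<in> L2_span (range wave)" .
  moreover have "cos x \<noteq> cos y"
    using xy cos_inj_pi[of x y] pi_gt3 by auto
  ultimately show "\<exists>f. (\<lambda>x. complex_of_real (f x)) \<in> L2_span (range wave) \<and> f x \<noteq> f y" by blast
qed (use assms in auto)

text \<open>Uniform approximation on [0, 1] suffices because that interval has full mass, and the
  approximating waves of real frequency already lie in the closed span.\<close>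

lemma closure_expo_base4: "L2_closure jp_measure expo_base4 = L2_functions jp_measure"
proof (rule L2_closure_eq_L2_of_continuous[OF jp.finite_measure_axioms sets_jp expo_subset_L2])
  fix g :: "real \<Rightarrow> real" assume g: "continuous_on UNIV g" "range g \<subseteq> {0..1}"
  have gL2: "(\<lambda>x. complex_of_real (g x)) \<in> L2_functions jp_measure"
  proof (rule L2_functions_bounded[OF jp.finite_measure_axioms])
    have "continuous_on UNIV (\<lambda>x. complex_of_real (g x))"
      using g(1) by (rule continuous_on_of_real)
    then show "(\<lambda>x. complex_of_real (g x)) \<in> borel_measurable jp_measure"
      unfolding measurable_cong_sets[OF sets_jp refl] by (rule borel_measurable_continuous_onI)
    show "cmod (complex_of_real (g x)) \<le> 1" for x
      using g(2) by (auto simp: image_subset_iff)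
  qed
  show "(\<lambda>x. complex_of_real (g x)) \<in> L2_closure jp_measure expo_base4"
  proof (rule L2_closure_limit[OF expo_subset_L2 gL2])
    fix \<epsilon> :: real assume \<epsilon>: "\<epsilon> > 0"
    then have "sqrt (\<epsilon> / 2) > 0" by simp
    with wave_span_dense[OF continuous_on_subset[OF g(1) subset_UNIV]]
    obtain f where f: "(\<lambda>x. complex_of_real (f x)) \<in> L2_span (range wave)"
      "\<forall>x\<in>{0..1}. \<bar>g x - f x\<bar> < sqrt (\<epsilon> / 2)" by blast
    have f': "(\<lambda>x. complex_of_real (f x)) \<in> L2_closure jp_measure expo_base4"
      using wave_in_closure by (intro L2_closure_span[OF expo_subset_L2 _ f(1)]) auto
    have "(\<integral>x. (cmod (complex_of_real (g x) - complex_of_real (f x)))\<^sup>2 \<partial>jp_measure)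
        \<le> (\<integral>x. \<epsilon> / 2 \<partial>jp_measure)"
    proof (rule integral_mono_AE)
      show "integrable jp_measure (\<lambda>x. (cmod (complex_of_real (g x) - complex_of_real (f x)))\<^sup>2)"
        by (intro L2_functions_integrable L2_functions_diff gL2 L2_closure_subset_L2[OF f'])
      show "AE x in jp_measure. (cmod (complex_of_real (g x) - complex_of_real (f x)))\<^sup>2 \<le> \<epsilon> / 2"
        using AE_jp_unit_interval
      proof eventually_elim
        case (elim x)
        then have "\<bar>g x - f x\<bar> < sqrt (\<epsilon> / 2)" using f(2) by blast
        then have "\<bar>g x - f x\<bar>\<^sup>2 \<le> (sqrt (\<epsilon> / 2))\<^sup>2" by (intro power_mono) auto
        then show ?case using \<epsilon> by (simp flip: of_real_diff)
      qed
    qed simp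
    also have "\<dots> < \<epsilon>" using \<epsilon> jp.prob_space by simp
    finally show "\<exists>h\<in>L2_closure jp_measure expo_base4.
        (\<integral>x. (cmod (complex_of_real (g x) - h x))\<^sup>2 \<partial>jp_measure) < \<epsilon>"
      using f' by (rule rev_bexI[rotated])
  qed
qed

section \<open>Complete, incomplete and primitive numbers\<close>

lemma complete_number_one: "complete_number 1"
proof -
  have "L2_orthonormal_basis jp_measure expo_base4"
  proof (rule L2_orthonormal_basisI[OF expo_subset_L2 _ closure_expo_base4])
    fix f g assume "f \<in> expo_base4" "g \<in> expo_base4"
    then obtain a b where ab: "a \<in> base4" "b \<in> base4" "f = expo a" "g = expo b" by blast
    \<comment> \<open>A basis compares functions, while the orthogonality lemma compares indices;
      equal functions with different indices would give 0 = 1.\<close>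
    have "a = b" if "f = g"
      using L2_inner_expo_base4[OF ab(1,2)] L2_inner_expo_base4[OF ab(1,1)] that ab(3,4)
      by (auto split: if_splits)
    then show "L2_inner jp_measure f g = (if f = g then 1 else 0)"
      using L2_inner_expo_base4[OF ab(1,2)] ab(3,4) by auto
  qed
  moreover have "\<Gamma> 1 = base4" by (simp add: \<Gamma>_eq)
  ultimately show ?thesis by (simp add: complete_number_def)
qed

lemma incomplete_number_repunit:
  assumes "odd m" "3 * m + 1 = 4 ^ (r + 3)"
  shows "incomplete_number m"
proof -
  have "\<not> L2_orthonormal_basis jp_measure {expo n | n. n \<in> \<Gamma> m}"
  proof (rule not_L2_orthonormal_basis_of_orthogonal[OF wave_L2 L2_square_wave])
    fix g assume "g \<in> {expo n | n. n \<in> \<Gamma> m}"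
    then obtain a where a: "a \<in> base4" "g = wave (real (m * a))"
      unfolding \<Gamma>_eq by (auto simp: expo_eq_wave)
    have "jp_char (of_int (- (7 + int (m * a)))) = 0"
      by (intro jp_char_even_valuation even_valuation_neg seven_add_even_valuation[OF a(1) assms(2)])
    then show "L2_inner jp_measure (wave (- 7)) g = 0"
      by (simp add: a(2) L2_inner_wave)
  qed
  with assms(1) show ?thesis
    by (simp add: incomplete_number_def complete_number_def)
qed

lemma incomplete_has_primitive_divisor:
  assumes "incomplete_number m"
  obtains d where "primitive_number d" "d dvd m"
proof -
  define d where "d = (LEAST d. d dvd m \<and> incomplete_number d)"
  have d: "d dvd m \<and> incomplete_number d"
    unfolding d_def by (rule LeastI[of _ m]) (simp add: assms)
  have "complete_number k" if "k dvd d" "k < d" for k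
  proof (rule ccontr)
    assume "\<not> complete_number k"
    \<comment> \<open>Even numbers count as neither complete nor incomplete, so failing to be
      complete yields incompleteness only for odd \<open>k\<close>.\<close>
    moreover have "odd k"
      using that(1) d dvd_trans[of 2 k d] by (auto simp: incomplete_number_def)
    ultimately have "k dvd m \<and> incomplete_number k"
      using that(1) d dvd_trans by (auto simp: incomplete_number_def)
    then have "d \<le> k" unfolding d_def by (rule Least_le)
    with that(2) show False by simp
  qed
  with d have "primitive_number d" by (simp add: primitive_number_def)
  then show thesis using d that by blast
qed

theorem theorem2p2:
  shows "infinite {m :: nat. primitive_number m}"
proof
  assume fin: "finite {m. primitive_number m}"
  define N where "N = \<Prod>{m. primitive_number m}"
  \<comment> \<open>Oddness makes 4 invertible modulo 3 N, as Euler's theorem requires.\<close>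
  have "odd p" if "primitive_number p" for p
    using that by (simp add: primitive_number_def incomplete_number_def)
  then have "odd N" unfolding N_def using fin by (simp add: even_prod_iff)
  then obtain m r where m: "3 * m + 1 = 4 ^ (r + 3)" "coprime m N" "odd m"
    by (rule exists_coprime_repunit)
  have "incomplete_number m" using m(3,1) by (rule incomplete_number_repunit)
  then obtain d where d: "primitive_number d" "d dvd m" by (rule incomplete_has_primitive_divisor)
  have "d dvd N" unfolding N_def using fin d(1) by (intro dvd_prodI) auto
  \<comment> \<open>The primitive divisor \<open>d\<close> divides both m and N, which are coprime,
    and 1 is complete.\<close>
  with m(2) d(2) have "d = 1" using coprime_common_divisor by fastforce
  with d(1) complete_number_one show False
    by (simp add: primitive_number_def incomplete_number_def)
qed

end
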